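(* Assume that $f\in L^2(X,\nu)$ and let $\lambda>0$. Then, for $u_\lambda\in L^1(X,\nu)$, $u_\lambda\in M(f,\lambda)$ if, and only if, there exists $\xi\in\mathrm{sign}(u_\lambda-f)$ such that $$\lambda\,\xi\in\Delta_1^m(u_\lambda).$$
   Context: Setting: $(X,d)$ is a Polish metric space with its Borel $\sigma$-algebra. A random walk $m=(m_x)_{x\in X}$ on $X$ is a family of Borel probability measures on $X$ such that $x\mapsto m_x(A)$ is Borel for every Borel $A\subset X$ and $\int_X d(z,y)\,dm_x(y)<\infty$ for all $x\in X$ and some (hence any) $z\in X$; $[X,d,m]$ is a metric random walk space. $\nu$ is a finite (nonzero) Radon measure on $X$ which is reversible for $m$: $dm_x(y)d\nu(x)=dm_y(x)d\nu(y)$ as measures on $X\times X$ (this implies invariance, $\nu(A)=\int_X m_x(A)\,d\nu(x)$). It is also assumed that $\frac1{\nu(X)}\nu$ is ergodic with respect to $m$: every Borel set $B$ with $m_x(B)=1$ for all $x\in B$ satisfies $\nu(B)=0$ or $\nu(B)=\nu(X)$. $m$-total variation: $TV_m(u)=\frac12\int_X\int_X|u(y)-u(x)|\,dm_x(y)\,d\nu(x)$. $\mathcal F_m:L^2(X,\nu)\to\,]-\infty,+\infty]$, $\mathcal F_m(u)=TV_m(u)$, is convex and lower semicontinuous; $\partial\mathcal F_m$ is its subdifferential in $L^2(X,\nu)$. The multivalued operator $\Delta_1^m$ in $L^2(X,\nu)$ is defined by: $v\in\Delta_1^m(u)$ iff $u,v\in L^2(X,\nu)$ and $-v\in\partial\mathcal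 F_m(u)$. For $f\in L^1(X,\nu)$ and $\lambda>0$: $\mathcal E_m(u,f,\lambda)=TV_m(u)+\lambda\int_X|u-f|\,d\nu$ for $u\in L^1(X,\nu)$, and $M(f,\lambda)$ is the set of $u\in L^1(X,\nu)$ that minimize $\mathcal E_m(\cdot,f,\lambda)$ over $L^1(X,\nu)$. $\mathrm{sign}$ is the multivalued sign: $\mathrm{sign}(r)=\{1\}$ if $r>0$, $\{-1\}$ if $r<0$, $[-1,1]$ if $r=0$; $\xi\in\mathrm{sign}(w)$ for a function $w$ means $\xi$ is a $\nu$-measurable function with $\xi(x)\in\mathrm{sign}(w(x))$ for $\nu$-a.e. $x$. *)

theory Defs
  imports "HOL-Probability.Probability"
begin

(* The Polish metric space X is a type of class polish_space; the two assumptions on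
   m x below make it a Borel probability measure.  In the moment condition, "for some z"
   and "for all z" agree by the triangle inequality. *)
definition metric_random_walk :: "('a::polish_space \<Rightarrow> 'a measure) \<Rightarrow> bool" where
  "metric_random_walk m \<longleftrightarrow>
     (\<forall>x. sets (m x) = sets borel \<and> prob_space (m x)) \<and>
     (\<forall>A\<in>sets borel. (\<lambda>x. emeasure (m x) A) \<in> borel_measurable borel) \<and>
     (\<exists>z. \<forall>x. (\<integral>\<^sup>+ y. ennreal (dist z y) \<partial>m x) < \<infinity>)"

definition radon_measure :: "'a::polish_space measure \<Rightarrow> bool" where
  "radon_measure \<nu> \<longleftrightarrow>
     sets \<nu> = sets borel \<and>
     (\<forall>K. compact K \<longrightarrow> emeasure \<nu> K < \<infinity>) \<and>
     (\<forall>B\<in>sets borel. emeasure \<nu> B = (SUP K\<in>{K. compact K \<and> K \<subseteq> B}. emeasure \<nu> K))"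

(* Equality of the measures dm_x(y) d\<nu>(x) and dm_y(x) d\<nu>(y) on X \<times> X, tested on
   every measurable set C. *)
definition reversible :: "('a::polish_space \<Rightarrow> 'a measure) \<Rightarrow> 'a measure \<Rightarrow> bool" where
  "reversible m \<nu> \<longleftrightarrow>
     (\<forall>C\<in>sets (borel \<Otimes>\<^sub>M borel).
        (\<integral>\<^sup>+ x. emeasure (m x) {y. (x, y) \<in> C} \<partial>\<nu>) =
        (\<integral>\<^sup>+ y. emeasure (m y) {x. (x, y) \<in> C} \<partial>\<nu>))"

definition ergodic :: "('a::polish_space \<Rightarrow> 'a measure) \<Rightarrow> 'a measure \<Rightarrow> bool" where
  "ergodic m \<nu> \<longleftrightarrow>
     (\<forall>B\<in>sets borel. (\<forall>x\<in>B. emeasure (m x) B = 1) \<longrightarrow>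
        emeasure \<nu> B = 0 \<or> emeasure \<nu> B = emeasure \<nu> UNIV)"

(* Elements of the Lebesgue spaces are represented by functions. *)
definition L1 :: "'a measure \<Rightarrow> ('a \<Rightarrow> real) set" where
  "L1 \<nu> = {u. integrable \<nu> u}"

definition L2 :: "'a measure \<Rightarrow> ('a \<Rightarrow> real) set" where
  "L2 \<nu> = {u \<in> borel_measurable \<nu>. integrable \<nu> (\<lambda>x. (u x)\<^sup>2)}"

definition TV :: "('a \<Rightarrow> 'a measure) \<Rightarrow> 'a measure \<Rightarrow> ('a \<Rightarrow> real) \<Rightarrow> ennreal" where
  "TV m \<nu> u = (1/2) * (\<integral>\<^sup>+ x. (\<integral>\<^sup>+ y. ennreal \<bar>u y - u x\<bar> \<partial>m x) \<partial>\<nu>)"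

(* For proper F the inequality forces F u < \<infinity>, so no domain condition is needed. *)
definition subdifferential ::
  "'a measure \<Rightarrow> (('a \<Rightarrow> real) \<Rightarrow> ereal) \<Rightarrow> ('a \<Rightarrow> real) \<Rightarrow> ('a \<Rightarrow> real) set" where
  "subdifferential \<nu> F u =
     {v. u \<in> L2 \<nu> \<and> v \<in> L2 \<nu> \<and>
         (\<forall>w\<in>L2 \<nu>. F u + ereal (LINT x|\<nu>. v x * (w x - u x)) \<le> F w)}"

(* The functional on L2; only its values there are used. *)
definition F_TV :: "('a \<Rightarrow> 'a measure) \<Rightarrow> 'a measure \<Rightarrow> ('a \<Rightarrow> real) \<Rightarrow> ereal" where
  "F_TV m \<nu> u = enn2ereal (TV m \<nu> u)"

definition one_laplacian ::
  "('a \<Rightarrow> 'a measure) \<Rightarrow> 'a measure \<Rightarrow> ('a \<Rightarrow> real) \<Rightarrow> ('a \<Rightarrow> real) set" where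
  "one_laplacian m \<nu> u =
     {v. u \<in> L2 \<nu> \<and> v \<in> L2 \<nu> \<and> (\<lambda>x. - v x) \<in> subdifferential \<nu> (F_TV m \<nu>) u}"

definition energy ::
  "('a \<Rightarrow> 'a measure) \<Rightarrow> 'a measure \<Rightarrow> ('a \<Rightarrow> real) \<Rightarrow> real \<Rightarrow> ('a \<Rightarrow> real) \<Rightarrow> ereal" where
  "energy m \<nu> f lam u =
     enn2ereal (TV m \<nu> u) + ereal (lam * (LINT x|\<nu>. \<bar>u x - f x\<bar>))"

definition minimizers ::
  "('a \<Rightarrow> 'a measure) \<Rightarrow> 'a measure \<Rightarrow> ('a \<Rightarrow> real) \<Rightarrow> real \<Rightarrow> ('a \<Rightarrow> real) set" where
  "minimizers m \<nu> f lam =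
     {u \<in> L1 \<nu>. \<forall>w\<in>L1 \<nu>. energy m \<nu> f lam u \<le> energy m \<nu> f lam w}"

definition multi_sign :: "real \<Rightarrow> real set" where
  "multi_sign r = (if r > 0 then {1} else if r < 0 then {-1} else {-1..1})"

definition sign_selections :: "'a measure \<Rightarrow> ('a \<Rightarrow> real) \<Rightarrow> ('a \<Rightarrow> real) set" where
  "sign_selections \<nu> w = {\<xi> \<in> borel_measurable \<nu>. AE x in \<nu>. \<xi> x \<in> multi_sign (w x)}"

end

theory Submission
  imports Defs
begin

text \<open>
  With \<open>TV\<close> the total variation and \<open>G u\<close> the \<open>L\<^sup>1\<close> distance of \<open>u\<close> to \<open>f\<close>, the theorem is the optimality
  condition \<open>0 \<in> \<partial>TV(u) + lam \<partial>G(u)\<close> for the convex energy \<open>TV + lam G\<close>. The energy is minimized over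
  \<open>L\<^sup>1\<close>, while the subdifferential lives in \<open>L\<^sup>2\<close>, so both directions have to pass between the two spaces.

  From a subgradient to a minimizer (\<open>subgradient_imp_minimizer\<close>): the subgradient inequalities of
  \<open>TV\<close> and of the absolute value add up to minimality over \<open>L\<^sup>2\<close>, and truncation extends it to \<open>L\<^sup>1\<close>.

  From a minimizer to a subgradient: first, a minimizer lies in \<open>L\<^sup>2\<close>, because clamping it at level \<open>k\<close>
  cannot lower its energy; integrating the resulting inequality over \<open>k\<close> bounds its \<open>L\<^sup>2\<close> norm by a
  multiple of that of \<open>f\<close> (\<open>minimizer_in_L2\<close>). Second, the sum rule. Let \<open>A\<close> be the set of \<open>lam \<xi>\<close> with \<open>\<xi> \<in> sign(u - f)\<close>
  and \<open>B\<close> the set of subgradients of \<open>TV\<close> at \<open>u\<close> bounded by \<open>1\<close>; some \<open>a \<in> A\<close> with \<open>- a \<in> B\<close> is wanted.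
  Since \<open>TV\<close> is half the integral of \<open>\<bar>u(y) - u(x)\<bar>\<close> against the symmetric measure \<open>dm\<^sub>x(y) d\<nu>(x)\<close>, its
  directional derivative in a direction \<open>h\<close> is attained by an explicit subgradient \<open>b\<^sub>h \<in> B\<close>, minus the mean
  over one step of an antisymmetric sign field (\<open>dir_sgn_step_mean_subgradient\<close>); likewise there is an
  explicit \<open>a\<^sub>h \<in> A\<close> for the fidelity term. Minimality of \<open>u\<close> makes the pairing of \<open>a\<^sub>h + b\<^sub>h\<close> with \<open>h\<close>
  nonnegative for every bounded \<open>h\<close>.

  It remains to exchange quantifiers: to find one pair that works for all \<open>h\<close>. Instead of the
  Hahn-Banach theorem and weak compactness, \<open>opposite_elements_of_bounded_convex_closed\<close> uses the geometry
  of \<open>L\<^sup>2\<close>: a Frank-Wolfe iteration finds elements of \<open>A + B\<close> of arbitrarily small norm, and almost minimal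
  elements of the nested convex sets of admissible \<open>a\<close> converge strongly by the parallelogram identity.
\<close>

section \<open>Separation of bounded convex sets in \<open>L\<^sup>2\<close>\<close>

text \<open>Closedness refers to almost everywhere limits because these are what a convergent sequence
in \<open>L\<^sup>2\<close> yields along a subsequence.\<close>

definition bounded_convex_closed :: "'a measure \<Rightarrow> real \<Rightarrow> ('a \<Rightarrow> real) set \<Rightarrow> bool" where
  "bounded_convex_closed M R A \<longleftrightarrow>
     (\<forall>a\<in>A. a \<in> borel_measurable M \<and> (AE x in M. \<bar>a x\<bar> \<le> R)) \<and>
     (\<forall>a\<in>A. \<forall>a'\<in>A. \<forall>t\<in>{0..1}. (\<lambda>x. (1 - t) * a x + t * a' x) \<in> A) \<and>
     (\<forall>s a. (\<forall>n. s n \<in> A) \<longrightarrow> a \<in> borel_measurable M \<longrightarrow>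
        (AE x in M. (\<lambda>n::nat. s n x) \<longlonglongrightarrow> a x) \<longrightarrow> a \<in> A)"

lemma bounded_convex_closedD:
  assumes "bounded_convex_closed M R A"
  shows "a \<in> A \<Longrightarrow> a \<in> borel_measurable M"
    and "a \<in> A \<Longrightarrow> AE x in M. \<bar>a x\<bar> \<le> R"
    and "a \<in> A \<Longrightarrow> a' \<in> A \<Longrightarrow> 0 \<le> t \<Longrightarrow> t \<le> 1 \<Longrightarrow> (\<lambda>x. (1 - t) * a x + t * a' x) \<in> A"
    and "(\<And>n. s n \<in> A) \<Longrightarrow> a \<in> borel_measurable M \<Longrightarrow>
           AE x in M. (\<lambda>n::nat. s n x) \<longlonglongrightarrow> a x \<Longrightarrow> a \<in> A"
  using assms unfolding bounded_convex_closed_def by (simp, simp, simp, blast)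

lemma integrable_bounded_mult:
  fixes b w :: "'a \<Rightarrow> real"
  assumes "integrable M w" and [measurable]: "b \<in> borel_measurable M"
    and "AE x in M. \<bar>b x\<bar> \<le> R"
  shows "integrable M (\<lambda>x. b x * w x)"
proof (rule Bochner_Integration.integrable_bound)
  show "integrable M (\<lambda>x. R * w x)" using assms by simp
  show "AE x in M. norm (b x * w x) \<le> norm (R * w x)"
    using assms(3) by eventually_elim (auto simp: abs_mult intro!: mult_right_mono)
  show "(\<lambda>x. b x * w x) \<in> borel_measurable M"
    using assms(1) by measurable
qed

context finite_measure
begin

lemma integrable_AE_bounded:
  fixes a :: "'a \<Rightarrow> real"
  assumes "a \<in> borel_measurable M" "AE x in M. \<bar>a x\<bar> \<le> R"
  shows "integrable M a"
  using assms by (intro integrable_const_bound[where B=R]) auto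

lemma integrable_AE_bounded_mult:
  fixes a b :: "'a \<Rightarrow> real"
  assumes "a \<in> borel_measurable M" "AE x in M. \<bar>a x\<bar> \<le> R"
    and "b \<in> borel_measurable M" "AE x in M. \<bar>b x\<bar> \<le> R'"
  shows "integrable M (\<lambda>x. a x * b x)"
  using assms by (intro integrable_bounded_mult[of _ _ _ R] integrable_AE_bounded[of b R'])

text \<open>A Frank-Wolfe iteration for the squared norm. If every \<open>c \<in> C\<close> has some \<open>c' \<in> C\<close> at a
right or obtuse angle, then the step \<open>(1 - t) c + t c'\<close> with \<open>t = 1 / (n + 2)\<close> loses the mixed term,
and \<open>(1 - t)\<^sup>2 / (n + 1) + t\<^sup>2 = 1 / (n + 2)\<close> makes the rate \<open>1 / (n + 1)\<close> reproduce itself.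
So \<open>0\<close> lies in the closure of \<open>C\<close>.\<close>

lemma small_norm_in_convex_set:
  fixes C :: "('a \<Rightarrow> real) set"
  assumes ne: "C \<noteq> {}"
    and meas: "\<And>c. c \<in> C \<Longrightarrow> c \<in> borel_measurable M"
    and bdd: "\<And>c. c \<in> C \<Longrightarrow> AE x in M. \<bar>c x\<bar> \<le> K"
    and conv: "\<And>c c' t. c \<in> C \<Longrightarrow> c' \<in> C \<Longrightarrow> 0 \<le> t \<Longrightarrow> t \<le> 1 \<Longrightarrow>
                 (\<lambda>x. (1 - t) * c x + t * c' x) \<in> C"
    and desc: "\<And>c. c \<in> C \<Longrightarrow> \<exists>c'\<in>C. (LINT x|M. c x * c' x) \<le> 0"
  shows "\<exists>c\<in>C. (LINT x|M. (c x)\<^sup>2) \<le> K\<^sup>2 * measure M (space M) / (real n + 1)"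
proof (induction n)
  case 0
  have sq: "(LINT x|M. (c x)\<^sup>2) \<le> K\<^sup>2 * measure M (space M)" if c: "c \<in> C" for c
  proof -
    have "(LINT x|M. (c x)\<^sup>2) \<le> (LINT x|M. K\<^sup>2)"
    proof (rule integral_mono_AE)
      show "integrable M (\<lambda>x. (c x)\<^sup>2)"
        using integrable_AE_bounded_mult[OF meas[OF c] bdd[OF c] meas[OF c] bdd[OF c]]
        by (simp add: power2_eq_square)
      show "AE x in M. (c x)\<^sup>2 \<le> K\<^sup>2"
        using bdd[OF c] by eventually_elim (metis abs_ge_zero power2_abs power_mono)
    qed simp
    then show ?thesis by (simp add: mult.commute)
  qed
  then show ?case using ne by auto
next
  case (Suc n)
  let ?W = "K\<^sup>2 * measure M (space M)"
  obtain c where c: "c \<in> C" "(LINT x|M. (c x)\<^sup>2) \<le> ?W / (real n + 1)"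
    using Suc by blast
  obtain c' where c': "c' \<in> C" "(LINT x|M. c x * c' x) \<le> 0"
    using desc[OF c(1)] by blast
  define t where "t = 1 / (real n + 2)"
  have t: "0 \<le> t" "t \<le> 1" by (auto simp: t_def)
  have i: "integrable M (\<lambda>x. d x * d' x)" if "d \<in> C" "d' \<in> C" for d d'
    using integrable_AE_bounded_mult[OF meas[OF that(1)] bdd[OF that(1)] meas[OF that(2)] bdd[OF that(2)]] .
  have "(LINT x|M. ((1 - t) * c x + t * c' x)\<^sup>2)
      = (LINT x|M. (1 - t)\<^sup>2 * (c x * c x) + (2 * t * (1 - t)) * (c x * c' x) + t\<^sup>2 * (c' x * c' x))"
    by (intro Bochner_Integration.integral_cong refl) (simp add: power2_eq_square algebra_simps)
  also have "\<dots> = (1 - t)\<^sup>2 * (LINT x|M. c x * c x) + (2 * t * (1 - t)) * (LINT x|M. c x * c' x)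
        + t\<^sup>2 * (LINT x|M. c' x * c' x)"
    using c(1) c'(1) i by simp
  also have "\<dots> \<le> (1 - t)\<^sup>2 * (?W / (real n + 1)) + 0 + t\<^sup>2 * ?W"
  proof (intro add_mono mult_left_mono)
    show "(LINT x|M. c x * c x) \<le> ?W / (real n + 1)" using c by (simp add: power2_eq_square)
    show "2 * t * (1 - t) * (LINT x|M. c x * c' x) \<le> 0"
      using c'(2) t by (intro mult_nonneg_nonpos) auto
    have "(LINT x|M. c' x * c' x) \<le> (LINT x|M. K\<^sup>2)"
    proof (rule integral_mono_AE)
      show "AE x in M. c' x * c' x \<le> K\<^sup>2"
        using bdd[OF c'(1)]
        by eventually_elim (metis abs_ge_zero power2_abs power2_eq_square power_mono)
    qed (use i c'(1) in simp_all)
    then show "(LINT x|M. c' x * c' x) \<le> ?W" by (simp add: mult.commute)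
  qed auto
  also have "\<dots> = ?W * ((1 - t)\<^sup>2 / (real n + 1) + t\<^sup>2)" by (simp add: algebra_simps)
  also have "(1 - t)\<^sup>2 / (real n + 1) + t\<^sup>2 = 1 / (real n + 2)"
  proof -
    have "1 - t = (real n + 1) / (real n + 2)" by (simp add: t_def field_simps)
    then show ?thesis by (simp add: t_def power2_eq_square divide_simps) (simp add: algebra_simps)
  qed
  finally show ?case
    by (intro bexI[OF _ conv[OF c(1) c'(1) t]]) (simp add: add.commute)
qed

text \<open>This takes the place of weak compactness: for a decreasing sequence of bounded convex sets,
almost minimal elements of \<open>K n\<close> form a Cauchy sequence in \<open>L\<^sup>2\<close>. Indeed the infima \<open>d n\<close> of the
squared norms increase to a finite limit, and the midpoint of two elements of \<open>K n\<close> has squared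
norm at least \<open>d n\<close>, so the parallelogram identity bounds their distance. A subsequence converges
almost everywhere, and it may replace the sequence because the sets decrease.\<close>

lemma AE_convergent_selection:
  fixes K :: "nat \<Rightarrow> ('a \<Rightarrow> real) set"
  assumes ne: "\<And>n. K n \<noteq> {}"
    and dec: "\<And>n k. n \<le> k \<Longrightarrow> K k \<subseteq> K n"
    and meas: "\<And>n a. a \<in> K n \<Longrightarrow> a \<in> borel_measurable M"
    and bdd: "\<And>n a. a \<in> K n \<Longrightarrow> AE x in M. \<bar>a x\<bar> \<le> R"
    and mid: "\<And>n a b. a \<in> K n \<Longrightarrow> b \<in> K n \<Longrightarrow> (\<lambda>x. (a x + b x) / 2) \<in> K n"
  obtains s a where "\<And>n::nat. s n \<in> K n" "a \<in> borel_measurable M"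
    "AE x in M. (\<lambda>n. s n x) \<longlonglongrightarrow> a x"
proof -
  let ?N = "\<lambda>a. LINT x|M. (a x)\<^sup>2"
  define d where "d n = Inf (?N ` K n)" for n
  have i: "integrable M (\<lambda>x. a x * b x)" if "a \<in> K n" "b \<in> K k" for a b n k
    using integrable_AE_bounded_mult[OF meas[OF that(1)] bdd[OF that(1)] meas[OF that(2)] bdd[OF that(2)]] .
  have isq: "integrable M (\<lambda>x. (a x)\<^sup>2)" if "a \<in> K n" for a n
    using i[OF that that] by (simp add: power2_eq_square)
  have below: "bdd_below (?N ` K n)" for n
    by (rule bdd_belowI[of _ 0]) auto
  have dle: "d n \<le> ?N a" if "a \<in> K n" for a n
    unfolding d_def using below that by (intro cInf_lower) auto
  have ubd: "d n \<le> R\<^sup>2 * measure M (space M)" for n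
  proof -
    obtain a where a: "a \<in> K n" using ne[of n] by blast
    have "?N a \<le> (LINT x|M. R\<^sup>2)"
    proof (rule integral_mono_AE[OF isq[OF a]])
      show "AE x in M. (a x)\<^sup>2 \<le> R\<^sup>2"
        using bdd[OF a] by eventually_elim (metis abs_ge_zero power2_abs power_mono)
    qed simp
    with dle[OF a] show ?thesis by (simp add: mult.commute)
  qed
  have dinc: "d n \<le> d k" if "n \<le> k" for n k
    unfolding d_def using dec[OF that] ne below by (intro cInf_superset_mono) auto
  have "\<exists>a\<in>K n. ?N a < d n + 1 / (real n + 1)" for n
  proof -
    have "Inf (?N ` K n) < d n + 1 / (real n + 1)" by (simp add: d_def)
    then show ?thesis using cInf_less_iff[OF _ below] ne by auto
  qed
  then obtain s where s: "\<And>n. s n \<in> K n" "\<And>n. ?N (s n) < d n + 1 / (real n + 1)" by metis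
  have dconv: "convergent d"
    using incseq_convergent[of d] dinc ubd by (metis convergentI incseq_def)
  have par: "(LINT x|M. (s i x - s j x)\<^sup>2)
      \<le> 2 * (d (max i j) - d (min i j)) + 4 / (real (min i j) + 1)" (is "_ \<le> ?e i j") for i j
  proof -
    have *: "(LINT x|M. (s i x - s j x)\<^sup>2) \<le> ?e i j" if "i \<le> j" for i j
    proof -
      have sj: "s j \<in> K i" using s(1) dec[OF that] by blast
      have "(LINT x|M. (s i x - s j x)\<^sup>2)
          = (LINT x|M. 2 * (s i x)\<^sup>2 + 2 * (s j x)\<^sup>2 - 4 * ((s i x + s j x) / 2)\<^sup>2)"
        by (intro Bochner_Integration.integral_cong refl) (simp add: power2_eq_square field_simps)
      also have "\<dots> = 2 * ?N (s i) + 2 * ?N (s j) - 4 * (LINT x|M. ((s i x + s j x) / 2)\<^sup>2)"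
        using isq[OF s(1)] isq[OF mid[OF s(1) sj]] by simp
      also have "\<dots> \<le> 2 * (d i + 1 / (real i + 1)) + 2 * (d j + 1 / (real i + 1)) - 4 * d i"
      proof -
        have "1 / (real j + 1) \<le> 1 / (real i + 1)" using that by (simp add: frac_le)
        then show ?thesis using s(2)[of i] s(2)[of j] dle[OF mid[OF s(1) sj]] by (smt (verit))
      qed
      finally show ?thesis using that by (simp add: min_def max_def)
    qed
    show ?thesis
    proof (cases "i \<le> j")
      case True then show ?thesis by (rule *)
    next
      case False
      then have "(LINT x|M. (s j x - s i x)\<^sup>2) \<le> ?e j i" by (intro *) simp
      then show ?thesis by (simp add: power2_commute min.commute max.commute)
    qed
  qed
  have is': "integrable M (s n)" for n
    using integrable_AE_bounded meas[OF s(1)] bdd[OF s(1)] .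
  have cauchy: "\<exists>N. \<forall>i\<ge>N. \<forall>j\<ge>N. (LINT x|M. norm (s i x - s j x)) < e" if e: "e > 0" for e
  proof -
    define \<mu> where "\<mu> = measure M (space M) + 1"
    have \<mu>: "\<mu> > 0" by (simp add: \<mu>_def add_nonneg_pos)
    define \<delta> where "\<delta> = e / (2 * \<mu>)"
    have \<delta>: "\<delta> > 0" using e \<mu> by (simp add: \<delta>_def)
    have "Cauchy d" using dconv by (rule convergent_Cauchy)
    then obtain N1 where N1: "\<And>i j. i \<ge> N1 \<Longrightarrow> j \<ge> N1 \<Longrightarrow> \<bar>d i - d j\<bar> < e * \<delta> / 8"
      using e \<delta> unfolding Cauchy_def dist_real_def
      by (metis divide_pos_pos mult_pos_pos zero_less_numeral)
    obtain N2 where N2: "1 / (real N2 + 1) < e * \<delta> / 16"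
      using e \<delta> reals_Archimedean[of "e * \<delta> / 16"] by (auto simp: inverse_eq_divide add.commute)
    show ?thesis
    proof (intro exI[of _ "max N1 N2"] allI impI)
      fix i j assume ij: "max N1 N2 \<le> i" "max N1 N2 \<le> j"
      have isd: "integrable M (\<lambda>x. (s i x - s j x)\<^sup>2)"
        using i[OF s(1) s(1), of i j] isq[OF s(1), of i] isq[OF s(1), of j]
        by (simp add: power2_diff mult.assoc)
      \<comment> \<open>From \<open>L\<^sup>2\<close> to \<open>L\<^sup>1\<close> by \<open>r \<le> \<delta> / 2 + r\<^sup>2 / (2 \<delta>)\<close>; the constant part integrates to at most \<open>e / 4\<close>.\<close>
      have "(LINT x|M. norm (s i x - s j x)) \<le> (LINT x|M. \<delta> / 2 + (s i x - s j x)\<^sup>2 / (2 * \<delta>))"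
      proof (intro integral_mono)
        fix x
        have "0 \<le> (\<bar>s i x - s j x\<bar> - \<delta>)\<^sup>2" by simp
        then have "2 * \<delta> * \<bar>s i x - s j x\<bar> \<le> \<delta>\<^sup>2 + (s i x - s j x)\<^sup>2"
          by (simp add: power2_diff mult.commute mult.left_commute)
        then show "norm (s i x - s j x) \<le> \<delta> / 2 + (s i x - s j x)\<^sup>2 / (2 * \<delta>)"
          using \<delta> by (simp add: field_simps power2_eq_square)
      qed (use is' isd in auto)
      also have "\<dots> = \<delta> / 2 * measure M (space M) + (LINT x|M. (s i x - s j x)\<^sup>2) / (2 * \<delta>)"
        using isd by simp
      also have "\<dots> \<le> \<delta> / 2 * \<mu> + (e * \<delta> / 2) / (2 * \<delta>)"
      proof (intro add_mono mult_left_mono divide_right_mono)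
        have "d (max i j) - d (min i j) < e * \<delta> / 8"
          using N1[of "max i j" "min i j"] ij by linarith
        moreover have "4 / (real (min i j) + 1) \<le> 4 / (real N2 + 1)"
          using ij by (intro divide_left_mono) auto
        ultimately show "(LINT x|M. (s i x - s j x)\<^sup>2) \<le> e * \<delta> / 2"
          using par[of i j] N2 by simp
      qed (use \<delta> in \<open>auto simp: \<mu>_def\<close>)
      also have "\<dots> = e / 2" using \<delta> \<mu> by (simp add: \<delta>_def field_simps)
      also have "\<dots> < e" using e by simp
      finally show "(LINT x|M. norm (s i x - s j x)) < e" .
    qed
  qed
  obtain r where r: "strict_mono r" "AE x in M. Cauchy (\<lambda>i. s (r i) x)"
    using cauchy_L1_AE_cauchy_subseq[OF is' cauchy] by blast
  show thesis
  proof (rule that)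
    show "s (r n) \<in> K n" for n
      using s(1)[of "r n"] dec[OF seq_suble[OF r(1), of n]] by blast
    show "(\<lambda>x. lim (\<lambda>n. s (r n) x)) \<in> borel_measurable M"
      using meas[OF s(1)] by (intro borel_measurable_lim_metric)
    show "AE x in M. (\<lambda>n. s (r n) x) \<longlonglongrightarrow> lim (\<lambda>n. s (r n) x)"
      using r(2) by eventually_elim (simp add: Cauchy_convergent_iff convergent_LIMSEQ_iff)
  qed
qed

lemma AE_tendsto_subseq_of_norm:
  fixes c :: "nat \<Rightarrow> 'a \<Rightarrow> real"
  assumes [measurable]: "\<And>n. c n \<in> borel_measurable M"
    and isq: "\<And>n. integrable M (\<lambda>x. (c n x)\<^sup>2)"
    and lim: "(\<lambda>n. LINT x|M. (c n x)\<^sup>2) \<longlonglongrightarrow> 0"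
  obtains r where "strict_mono r" "AE x in M. (\<lambda>n. c (r n) x) \<longlonglongrightarrow> 0"
proof -
  obtain r where r: "strict_mono r" "AE x in M. (\<lambda>n. (c (r n) x)\<^sup>2) \<longlonglongrightarrow> 0"
    using tendsto_L1_AE_subseq[of M "\<lambda>n x. (c n x)\<^sup>2"] isq lim by auto
  have "AE x in M. (\<lambda>n. c (r n) x) \<longlonglongrightarrow> 0"
    using r(2) 
    by eventually_elim (drule tendsto_real_sqrt, simp add: tendsto_rabs_zero_iff)
  with r(1) show thesis by (rule that)
qed

text \<open>The separation argument behind the sum rule for subdifferentials. The hypothesis says that
no bounded function separates \<open>A + B\<close> strictly from \<open>0\<close>; applied to \<open>h = - c\<close> it is the descent
condition of the Frank-Wolfe iteration, so \<open>A + B\<close> has elements of arbitrarily small norm. The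
summands from \<open>A\<close> that occur at level \<open>1 / (n + 1)\<close> form decreasing convex sets. A convergent
selection from them has a limit \<open>a \<in> A\<close>, and then the partners from \<open>B\<close> converge to \<open>- a\<close>.\<close>

proposition opposite_elements_of_bounded_convex_closed:
  fixes A B :: "('a \<Rightarrow> real) set"
  assumes "0 \<le> R" and A: "bounded_convex_closed M R A" and B: "bounded_convex_closed M R B"
    and supp: "\<And>h. h \<in> borel_measurable M \<Longrightarrow> AE x in M. \<bar>h x\<bar> \<le> 2 * R \<Longrightarrow>
       \<exists>a\<in>A. \<exists>b\<in>B. 0 \<le> (LINT x|M. (a x + b x) * h x)"
  obtains a where "a \<in> A" "(\<lambda>x. - a x) \<in> B"
proof -
  note Am = bounded_convex_closedD(1)[OF A] and Ab = bounded_convex_closedD(2)[OF A]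
    and Ac = bounded_convex_closedD(3)[OF A] and Al = bounded_convex_closedD(4)[OF A]
  note Bm = bounded_convex_closedD(1)[OF B] and Bb = bounded_convex_closedD(2)[OF B]
    and Bc = bounded_convex_closedD(3)[OF B] and Bl = bounded_convex_closedD(4)[OF B]
  define S where "S = {c. \<exists>a\<in>A. \<exists>b\<in>B. c = (\<lambda>x. a x + b x)}"
  have SI: "(\<lambda>x. a x + b x) \<in> S" if "a \<in> A" "b \<in> B" for a b
    using that unfolding S_def by blast
  define W where "W = (2 * R)\<^sup>2 * measure M (space M)"
  have ab_meas: "(\<lambda>x. a x + b x) \<in> borel_measurable M" if "a \<in> A" "b \<in> B" for a b
    using Am[OF that(1)] Bm[OF that(2)] by measurable
  have ab_bdd: "AE x in M. \<bar>a x + b x\<bar> \<le> 2 * R" if "a \<in> A" "b \<in> B" for a b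
    using Ab[OF that(1)] Bb[OF that(2)] by eventually_elim auto
  have ab_sq: "integrable M (\<lambda>x. (a x + b x)\<^sup>2)" if "a \<in> A" "b \<in> B" for a b
    using integrable_AE_bounded_mult[OF ab_meas[OF that] ab_bdd[OF that] ab_meas[OF that] ab_bdd[OF that]]
    by (simp add: power2_eq_square)
  have small: "\<exists>c\<in>S. (LINT x|M. (c x)\<^sup>2) \<le> W / (real n + 1)" for n
    unfolding W_def
  proof (rule small_norm_in_convex_set)
    have opp: "\<exists>a\<in>A. \<exists>b\<in>B. 0 \<le> (LINT x|M. (a x + b x) * - (a' x + b' x))" if "a' \<in> A" "b' \<in> B" for a' b'
    proof (rule supp)
      show "AE x in M. \<bar>- (a' x + b' x)\<bar> \<le> 2 * R" using ab_bdd[OF that] by eventually_elim linarith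
    qed (use ab_meas[OF that] in measurable)
    show "\<exists>c'\<in>S. (LINT x|M. c x * c' x) \<le> 0" if "c \<in> S" for c
    proof -
      obtain a' b' where c: "a' \<in> A" "b' \<in> B" "c = (\<lambda>x. a' x + b' x)"
        using \<open>c \<in> S\<close> unfolding S_def by blast
      obtain a b where ab: "a \<in> A" "b \<in> B" "0 \<le> (LINT x|M. (a x + b x) * - (a' x + b' x))"
        using opp[OF c(1,2)] by blast
      have "(LINT x|M. (a x + b x) * - (a' x + b' x)) = - (LINT x|M. c x * (a x + b x))"
        by (simp only: c(3) mult_minus_right integral_minus mult.commute)
      then have "(LINT x|M. c x * (a x + b x)) \<le> 0" using ab(3) by linarith
      then show ?thesis by (rule bexI[OF _ SI[OF ab(1,2)]])
    qed
    obtain a b where "a \<in> A" "b \<in> B"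
      using supp[of "\<lambda>_. 0"] \<open>0 \<le> R\<close> by auto
    then show "S \<noteq> {}" using SI by blast
  next
    fix c c' :: "'a \<Rightarrow> real" and t :: real
    assume "c \<in> S" "c' \<in> S" and t: "0 \<le> t" "t \<le> 1"
    then obtain a b a' b' where *: "a \<in> A" "b \<in> B" "c = (\<lambda>x. a x + b x)"
        "a' \<in> A" "b' \<in> B" "c' = (\<lambda>x. a' x + b' x)"
      unfolding S_def by blast
    have "(\<lambda>x. (1 - t) * c x + t * c' x)
        = (\<lambda>x. ((1 - t) * a x + t * a' x) + ((1 - t) * b x + t * b' x))"
      by (simp add: * algebra_simps)
    then show "(\<lambda>x. (1 - t) * c x + t * c' x) \<in> S"
      using SI[OF Ac[OF *(1,4) t] Bc[OF *(2,5) t]] by simp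
  qed (use ab_meas ab_bdd in \<open>auto simp: S_def\<close>)
  define K where
    "K n = {a \<in> A. \<exists>b\<in>B. (LINT x|M. (a x + b x)\<^sup>2) \<le> W / (real n + 1)}" for n
  have KI: "a \<in> K n"
    if "a \<in> A" "b \<in> B" "(LINT x|M. (a x + b x)\<^sup>2) \<le> W / (real n + 1)" for a b n
    using that unfolding K_def by blast
  have Kmid: "(\<lambda>x. (a x + a' x) / 2) \<in> K n" if "a \<in> K n" "a' \<in> K n" for a a' n
  proof -
    obtain b b' where *: "a \<in> A" "b \<in> B" "(LINT x|M. (a x + b x)\<^sup>2) \<le> W / (real n + 1)"
      "a' \<in> A" "b' \<in> B" "(LINT x|M. (a' x + b' x)\<^sup>2) \<le> W / (real n + 1)"
      using \<open>a \<in> K n\<close> \<open>a' \<in> K n\<close> unfolding K_def by blast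
    have half: "(\<lambda>x. (1 - 1/2) * p x + 1/2 * q x) = (\<lambda>x. (p x + q x) / 2)" for p q :: "'a \<Rightarrow> real"
      by (auto simp: field_simps)
    have aa: "(\<lambda>x. (a x + a' x) / 2) \<in> A" and bb: "(\<lambda>x. (b x + b' x) / 2) \<in> B"
      using Ac[OF *(1,4), of "1/2"] Bc[OF *(2,5), of "1/2"] unfolding half by auto
    have half_sum: "(v + v) / 2 = v" for v :: real by simp
    have "(LINT x|M. ((a x + a' x) / 2 + (b x + b' x) / 2)\<^sup>2)
        \<le> (LINT x|M. ((a x + b x)\<^sup>2 + (a' x + b' x)\<^sup>2) / 2)"
    proof (intro integral_mono)
      fix x
      have "0 \<le> ((a x + b x) - (a' x + b' x))\<^sup>2" by simp
      then show "((a x + a' x) / 2 + (b x + b' x) / 2)\<^sup>2 \<le> ((a x + b x)\<^sup>2 + (a' x + b' x)\<^sup>2) / 2"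
        by (simp add: power2_eq_square field_simps)
    qed (use ab_sq[OF aa bb] ab_sq[OF *(1,2)] ab_sq[OF *(4,5)] in auto)
    also have "\<dots> = ((LINT x|M. (a x + b x)\<^sup>2) + (LINT x|M. (a' x + b' x)\<^sup>2)) / 2"
      using ab_sq[OF *(1,2)] ab_sq[OF *(4,5)] by simp
    also have "\<dots> \<le> (W / (real n + 1) + W / (real n + 1)) / 2"
      by (intro divide_right_mono add_mono *(3,6)) simp
    also have "\<dots> = W / (real n + 1)" by (rule half_sum)
    finally show ?thesis by (rule KI[OF aa bb])
  qed
  obtain s a where s: "\<And>n. s n \<in> K n" and a: "a \<in> borel_measurable M"
      "AE x in M. (\<lambda>n. s n x) \<longlonglongrightarrow> a x"
  proof (rule AE_convergent_selection[of K R])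
    show "K n \<noteq> {}" for n
    proof -
      obtain c where c: "c \<in> S" "(LINT x|M. (c x)\<^sup>2) \<le> W / (real n + 1)"
        using small[of n] by blast
      obtain a b where "a \<in> A" "b \<in> B" "c = (\<lambda>x. a x + b x)"
        using c(1) unfolding S_def by blast
      with c(2) have "a \<in> K n" by (intro KI) simp_all
      then show ?thesis by blast
    qed
    show "K k \<subseteq> K n" if "n \<le> k" for n k
    proof -
      have "W / (real k + 1) \<le> W / (real n + 1)"
        using that by (intro divide_left_mono) (auto simp: W_def)
      then show ?thesis unfolding K_def by (auto intro: order_trans)
    qed
    show "a \<in> borel_measurable M" if "a \<in> K n" for a n using that Am by (simp add: K_def)
    show "AE x in M. \<bar>a x\<bar> \<le> R" if "a \<in> K n" for a n using that Ab by (simp add: K_def)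
    show "(\<lambda>x. (a x + a' x) / 2) \<in> K n" if "a \<in> K n" "a' \<in> K n" for a a' n
      using that by (rule Kmid)
  qed blast
  obtain b where b: "\<And>n. b n \<in> B" "\<And>n. (LINT x|M. (s n x + b n x)\<^sup>2) \<le> W / (real n + 1)"
  proof -
    have "\<forall>n. \<exists>b. b \<in> B \<and> (LINT x|M. (s n x + b x)\<^sup>2) \<le> W / (real n + 1)"
      using s unfolding K_def by blast
    from choice[OF this] show thesis using that by blast
  qed
  have sA: "s n \<in> A" for n using s[of n] by (simp add: K_def)
  have lim0: "(\<lambda>n. LINT x|M. (s n x + b n x)\<^sup>2) \<longlonglongrightarrow> 0"
  proof (rule tendsto_sandwich[OF _ _ tendsto_const])
    show "\<forall>\<^sub>F n in sequentially. (LINT x|M. (s n x + b n x)\<^sup>2) \<le> W / (real n + 1)"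
      using b(2) by simp
    show "(\<lambda>n. W / (real n + 1)) \<longlonglongrightarrow> 0"
      using LIMSEQ_Suc[OF lim_const_over_n[of W]] by (simp add: add.commute)
  qed simp
  obtain r where r: "strict_mono r" "AE x in M. (\<lambda>n. s (r n) x + b (r n) x) \<longlonglongrightarrow> 0"
    using AE_tendsto_subseq_of_norm[OF ab_meas[OF sA b(1)] ab_sq[OF sA b(1)] lim0] by blast
  have "AE x in M. (\<lambda>n. b (r n) x) \<longlonglongrightarrow> - a x"
    using a(2) r(2)
  proof eventually_elim
    fix x assume "(\<lambda>n. s n x) \<longlonglongrightarrow> a x" "(\<lambda>n. s (r n) x + b (r n) x) \<longlonglongrightarrow> 0"
    then have "(\<lambda>n. (s (r n) x + b (r n) x) - s (r n) x) \<longlonglongrightarrow> 0 - a x"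
      using LIMSEQ_subseq_LIMSEQ[OF _ r(1), of "\<lambda>n. s n x"]
      by (intro tendsto_diff) (simp_all add: o_def)
    then show "(\<lambda>n. b (r n) x) \<longlonglongrightarrow> - a x" by simp
  qed
  then have "(\<lambda>x. - a x) \<in> B"
    using Bl[of "\<lambda>n. b (r n)" "\<lambda>x. - a x"] b(1) borel_measurable_uminus[OF a(1)] by blast
  moreover have "a \<in> A" using sA a by (rule Al)
  ultimately show thesis using that by blast
qed

end

section \<open>One-sided derivatives of the absolute value\<close>

text \<open>\<open>dir_sgn p q * q\<close> is the one-sided derivative of the absolute value at \<open>p\<close> in direction \<open>q\<close>.
The value at \<open>p = 0\<close> is the choice from \<open>[-1, 1]\<close> that makes this product maximal.\<close>

definition dir_sgn :: "real \<Rightarrow> real \<Rightarrow> real" where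
  "dir_sgn p q = (if p \<noteq> 0 then sgn p else sgn q)"

lemma dir_sgn_measurable [measurable]:
  assumes [measurable]: "p \<in> borel_measurable M" "q \<in> borel_measurable M"
  shows "(\<lambda>x. dir_sgn (p x) (q x)) \<in> borel_measurable M"
  unfolding dir_sgn_def by measurable

lemma abs_dir_sgn_le: "\<bar>dir_sgn p q\<bar> \<le> 1"
  by (auto simp: dir_sgn_def sgn_if)

lemma dir_sgn_minus: "dir_sgn (- p) (- q) = - dir_sgn p q"
  by (auto simp: dir_sgn_def sgn_if)

lemma dir_sgn_in_multi_sign: "dir_sgn p q \<in> multi_sign p"
  by (auto simp: dir_sgn_def multi_sign_def sgn_if)

lemma abs_difference_quotient_tendsto:
  "(\<lambda>n. (\<bar>p + q / (real n + 1)\<bar> - \<bar>p\<bar>) * (real n + 1)) \<longlonglongrightarrow> dir_sgn p q * q"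
proof (cases "p = 0")
  case True
  then show ?thesis by (auto simp: dir_sgn_def sgn_if abs_if divide_less_0_iff)
next
  case False
  have "(\<lambda>n. q / (real n + 1)) \<longlonglongrightarrow> 0"
    using LIMSEQ_Suc[OF lim_const_over_n[of q]] by (simp add: add.commute)
  then have "eventually (\<lambda>n. \<bar>q / (real n + 1)\<bar> < \<bar>p\<bar>) sequentially"
    using False tendstoD[of "\<lambda>n. q / (real n + 1)" 0 sequentially "\<bar>p\<bar>"] by simp
  then have "eventually (\<lambda>n. (\<bar>p + q / (real n + 1)\<bar> - \<bar>p\<bar>) * (real n + 1) = dir_sgn p q * q) sequentially"
  proof eventually_elim
    fix n assume *: "\<bar>q / (real n + 1)\<bar> < \<bar>p\<bar>"
    then have "\<bar>p + q / (real n + 1)\<bar> - \<bar>p\<bar> = sgn p * (q / (real n + 1))"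
      using False by (auto simp: sgn_if abs_if split: if_splits)
    then show "(\<bar>p + q / (real n + 1)\<bar> - \<bar>p\<bar>) * (real n + 1) = dir_sgn p q * q"
      using False by (simp add: dir_sgn_def)
  qed
  then show ?thesis by (rule tendsto_eventually)
qed

text \<open>Difference quotients of the absolute value in direction \<open>q\<close> are dominated by \<open>\<bar>q\<bar>\<close>. The lemma
serves both for the fidelity term, with \<open>p = u - f\<close> on \<open>X\<close>, and for the total variation, with the
nonlocal gradient of \<open>u\<close> on \<open>X \<times> X\<close>.\<close>

lemma integral_abs_difference_quotient_tendsto:
  fixes p q :: "'a \<Rightarrow> real"
  assumes p: "integrable M p" and q: "integrable M q"
  shows "(\<lambda>n. ((LINT x|M. \<bar>p x + q x / (real n + 1)\<bar>) - (LINT x|M. \<bar>p x\<bar>)) * (real n + 1))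
           \<longlonglongrightarrow> (LINT x|M. dir_sgn (p x) (q x) * q x)"
proof -
  note [measurable] = borel_measurable_integrable[OF p] borel_measurable_integrable[OF q]
  have "(\<lambda>n. LINT x|M. (\<bar>p x + q x / (real n + 1)\<bar> - \<bar>p x\<bar>) * (real n + 1))
           \<longlonglongrightarrow> (LINT x|M. dir_sgn (p x) (q x) * q x)"
  proof (rule integral_dominated_convergence[where w="\<lambda>x. \<bar>q x\<bar>"])
    show "AE x in M. norm ((\<bar>p x + q x / (real n + 1)\<bar> - \<bar>p x\<bar>) * (real n + 1)) \<le> \<bar>q x\<bar>" for n
    proof (rule AE_I2)
      fix x
      have "\<bar>\<bar>p x + q x / (real n + 1)\<bar> - \<bar>p x\<bar>\<bar> \<le> \<bar>q x\<bar> / (real n + 1)"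
        using abs_triangle_ineq3[of "p x + q x / (real n + 1)" "p x"] by simp
      then show "norm ((\<bar>p x + q x / (real n + 1)\<bar> - \<bar>p x\<bar>) * (real n + 1)) \<le> \<bar>q x\<bar>"
        by (simp add: abs_mult pos_le_divide_eq)
    qed
  qed (use q abs_difference_quotient_tendsto in \<open>auto intro!: AE_I2\<close>)
  moreover have "(LINT x|M. (\<bar>p x + q x / (real n + 1)\<bar> - \<bar>p x\<bar>) * (real n + 1))
      = ((LINT x|M. \<bar>p x + q x / (real n + 1)\<bar>) - (LINT x|M. \<bar>p x\<bar>)) * (real n + 1)" for n
    using p q by simp
  ultimately show ?thesis by simp
qed

lemma multi_sign_convex:
  "\<lbrakk>a \<in> multi_sign r; b \<in> multi_sign r; 0 \<le> t; t \<le> 1\<rbrakk> \<Longrightarrow> (1 - t) * a + t * b \<in> multi_sign r"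
  using convex_bound_le[of a 1 b "1 - t" t] convex_bound_le[of "-a" 1 "-b" "1 - t" t]
  by (auto simp: multi_sign_def split: if_splits)

lemma multi_sign_closed:
  assumes "\<And>n::nat. s n \<in> multi_sign r" and "s \<longlonglongrightarrow> a"
  shows "a \<in> multi_sign r"
proof -
  have "closed (multi_sign r)" by (simp add: multi_sign_def)
  then show ?thesis using assms closed_sequentially by blast
qed

lemma abs_le_1_of_multi_sign: "a \<in> multi_sign r \<Longrightarrow> \<bar>a\<bar> \<le> 1"
  by (auto simp: multi_sign_def split: if_splits)

lemma multi_sign_subgradient_abs: "a \<in> multi_sign r \<Longrightarrow> a * (s - r) \<le> \<bar>s\<bar> - \<bar>r\<bar>"
proof -
  assume a: "a \<in> multi_sign r"
  then have "a * r = \<bar>r\<bar>" by (auto simp: multi_sign_def split: if_splits)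
  moreover have "a * s \<le> \<bar>s\<bar>"
    using mult_right_mono[OF abs_le_1_of_multi_sign[OF a], of "\<bar>s\<bar>"] abs_ge_self[of "a * s"]
    by (simp add: abs_mult)
  ultimately show ?thesis by (simp add: right_diff_distrib)
qed

section \<open>The total variation as an integral over pairs of points\<close>

locale reversible_walk =
  fixes m :: "'a::polish_space \<Rightarrow> 'a measure" and \<nu> :: "'a measure"
  assumes walk: "metric_random_walk m" and finite: "finite_measure \<nu>"
    and sets_\<nu> [measurable_cong]: "sets \<nu> = sets borel" and rev: "reversible m \<nu>"
begin

sublocale \<nu>: finite_measure \<nu> by (rule finite)

lemma space_\<nu> [simp]: "space \<nu> = UNIV"
  using sets_eq_imp_space_eq[OF sets_\<nu>] by simp

lemma sets_m [measurable_cong]: "sets (m x) = sets borel" and prob_m: "prob_space (m x)"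
  using walk unfolding metric_random_walk_def by auto

lemma space_m [simp]: "space (m x) = UNIV"
  using sets_eq_imp_space_eq[OF sets_m] by simp

lemma m_kernel [measurable]: "m \<in> measurable \<nu> (subprob_algebra borel)"
  using walk unfolding metric_random_walk_def
  by (intro measurable_subprob_algebra)
     (auto intro: prob_space_imp_subprob_space simp: measurable_cong_sets[OF sets_\<nu> refl])

text \<open>The measure \<open>dm\<^sub>x(y) d\<nu>(x)\<close> on \<open>X \<times> X\<close>, which distributes the two ends of one step
started from \<open>\<nu>\<close>. Reversibility is its symmetry, and both marginals are \<open>\<nu>\<close>.\<close>

definition joint :: "('a \<times> 'a) measure" where
  "joint = \<nu> \<bind> (\<lambda>x. distr (m x) (borel \<Otimes>\<^sub>M borel) (Pair x))"

lemma step_kernel [measurable]: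
  "(\<lambda>x. distr (m x) (borel \<Otimes>\<^sub>M borel) (Pair x)) \<in> measurable \<nu> (subprob_algebra (borel \<Otimes>\<^sub>M borel))"
  by (rule measurable_distr2[where M=borel]) measurable

lemma sets_joint [measurable_cong]: "sets joint = sets (borel \<Otimes>\<^sub>M borel)"
  unfolding joint_def by (rule sets_bind) auto

lemma space_joint [simp]: "space joint = UNIV"
  using sets_eq_imp_space_eq[OF sets_joint] by (simp add: space_pair_measure)

lemma nn_integral_joint:
  assumes [measurable]: "g \<in> borel_measurable (borel \<Otimes>\<^sub>M borel)"
  shows "(\<integral>\<^sup>+z. g z \<partial>joint) = (\<integral>\<^sup>+x. \<integral>\<^sup>+y. g (x, y) \<partial>m x \<partial>\<nu>)"
proof -
  have "(\<integral>\<^sup>+z. g z \<partial>joint)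
      = (\<integral>\<^sup>+x. \<integral>\<^sup>+z. g z \<partial>distr (m x) (borel \<Otimes>\<^sub>M borel) (Pair x) \<partial>\<nu>)"
    unfolding joint_def by (rule nn_integral_bind) measurable
  also have "\<dots> = (\<integral>\<^sup>+x. \<integral>\<^sup>+y. g (x, y) \<partial>m x \<partial>\<nu>)"
    by (intro nn_integral_cong nn_integral_distr) measurable
  finally show ?thesis .
qed

lemma emeasure_joint:
  assumes [measurable]: "C \<in> sets (borel \<Otimes>\<^sub>M borel)"
  shows "emeasure joint C = (\<integral>\<^sup>+x. emeasure (m x) {y. (x, y) \<in> C} \<partial>\<nu>)"
proof -
  have "emeasure joint C = (\<integral>\<^sup>+z. indicator C z \<partial>joint)"
    by (simp add: sets_joint)
  also have "\<dots> = (\<integral>\<^sup>+x. \<integral>\<^sup>+y. indicator C (x, y) \<partial>m x \<partial>\<nu>)"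
    by (rule nn_integral_joint) simp
  also have "\<dots> = (\<integral>\<^sup>+x. emeasure (m x) {y. (x, y) \<in> C} \<partial>\<nu>)"
  proof (intro nn_integral_cong)
    fix x
    have "{y. (x, y) \<in> C} \<in> sets borel"
      using sets_Pair1[OF assms, of x] by (simp add: vimage_def)
    then have "(\<integral>\<^sup>+y. indicator {y. (x, y) \<in> C} y \<partial>m x) = emeasure (m x) {y. (x, y) \<in> C}"
      by (simp add: sets_m)
    then show "(\<integral>\<^sup>+y. indicator C (x, y) \<partial>m x) = emeasure (m x) {y. (x, y) \<in> C}"
      by (simp add: indicator_def)
  qed
  finally show ?thesis .
qed

lemma distr_joint_swap: "distr joint joint prod.swap = joint"
proof (rule measure_eqI)
  fix C assume "C \<in> sets (distr joint joint prod.swap)"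
  then have C [measurable]: "C \<in> sets (borel \<Otimes>\<^sub>M borel)" by (simp add: sets_joint)
  have swap [measurable]: "prod.swap \<in> measurable (borel \<Otimes>\<^sub>M borel) (borel \<Otimes>\<^sub>M (borel :: 'a measure))"
    unfolding prod.swap_def by measurable
  have sC: "prod.swap -` C \<in> sets (borel \<Otimes>\<^sub>M borel)"
    using measurable_sets[OF swap C] by (simp add: space_pair_measure)
  have "emeasure (distr joint joint prod.swap) C = emeasure joint (prod.swap -` C)"
    by (subst emeasure_distr) auto
  also have "\<dots> = (\<integral>\<^sup>+x. emeasure (m x) {y. (y, x) \<in> C} \<partial>\<nu>)"
    by (simp add: emeasure_joint sC)
  also have "\<dots> = emeasure joint C"
    using rev C unfolding reversible_def by (simp add: emeasure_joint)
  finally show "emeasure (distr joint joint prod.swap) C = emeasure joint C" .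
qed simp

lemma distr_joint_fst: "distr joint \<nu> fst = \<nu>"
proof (rule measure_eqI)
  fix A assume "A \<in> sets (distr joint \<nu> fst)"
  then have A [measurable]: "A \<in> sets borel" by (simp add: sets_\<nu>)
  have A': "fst -` A \<in> sets (borel \<Otimes>\<^sub>M (borel :: 'a measure))"
    using measurable_sets[OF measurable_fst A, of "borel :: 'a measure"]
    by (simp add: space_pair_measure)
  have "emeasure (distr joint \<nu> fst) A = emeasure joint (fst -` A)"
    by (subst emeasure_distr) (auto simp: sets_\<nu>)
  also have "\<dots> = (\<integral>\<^sup>+x. emeasure (m x) {y. x \<in> A} \<partial>\<nu>)"
    by (simp add: emeasure_joint A')
  also have "\<dots> = (\<integral>\<^sup>+x. indicator A x \<partial>\<nu>)"
    using prob_space.emeasure_space_1[OF prob_m]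
    by (intro nn_integral_cong) (simp add: indicator_def)
  also have "\<dots> = emeasure \<nu> A" by (simp add: sets_\<nu>)
  finally show "emeasure (distr joint \<nu> fst) A = emeasure \<nu> A" .
qed simp

lemma distr_joint_snd: "distr joint \<nu> snd = \<nu>"
proof -
  have swap [measurable]: "prod.swap \<in> measurable joint joint"
    unfolding prod.swap_def by measurable
  have "distr joint \<nu> snd = distr (distr joint joint prod.swap) \<nu> fst"
    by (subst distr_distr) (auto simp: comp_def)
  then show ?thesis by (simp add: distr_joint_swap distr_joint_fst)
qed

sublocale joint: finite_measure joint
proof
  have "emeasure joint (space joint) = emeasure (distr joint \<nu> fst) UNIV"
    by (subst emeasure_distr) (auto simp: sets_\<nu>)
  then show "emeasure joint (space joint) \<noteq> \<infinity>"
    unfolding distr_joint_fst using \<nu>.emeasure_finite by simp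
qed

lemma integral_joint_swap:
  fixes g :: "'a \<times> 'a \<Rightarrow> real"
  assumes "g \<in> borel_measurable (borel \<Otimes>\<^sub>M borel)"
  shows "(LINT z|joint. g (prod.swap z)) = (LINT z|joint. g z)"
proof -
  have swap: "prod.swap \<in> measurable joint joint"
    unfolding prod.swap_def by measurable
  have "g \<in> borel_measurable joint" using assms by measurable
  then show ?thesis
    using integral_distr[OF swap, of g] by (simp add: distr_joint_swap)
qed

lemma integrable_joint_marginals:
  fixes w :: "'a \<Rightarrow> real"
  assumes "integrable \<nu> w"
  shows "integrable joint (\<lambda>z. w (fst z))" "integrable joint (\<lambda>z. w (snd z))"
  using assms integrable_distr[of fst joint \<nu> w] integrable_distr[of snd joint \<nu> w]
  by (simp_all add: distr_joint_fst distr_joint_snd)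

text \<open>The nonlocal gradient of a random walk space.\<close>

definition grad :: "('a \<Rightarrow> real) \<Rightarrow> 'a \<times> 'a \<Rightarrow> real" where
  "grad w z = w (snd z) - w (fst z)"

lemma grad_measurable [measurable (raw)]:
  assumes "w \<in> borel_measurable \<nu>"
  shows "grad w \<in> borel_measurable (borel \<Otimes>\<^sub>M borel)"
proof -
  have [measurable]: "w \<in> borel_measurable borel" using assms by measurable
  show ?thesis unfolding grad_def by measurable
qed

lemma integrable_grad: "integrable \<nu> w \<Longrightarrow> integrable joint (grad w)"
  unfolding grad_def by (intro Bochner_Integration.integrable_diff integrable_joint_marginals)

text \<open>The real-valued total variation, to be used for integrable functions only, where it is finite.\<close>

definition tv :: "('a \<Rightarrow> real) \<Rightarrow> real" where
  "tv w = (LINT z|joint. \<bar>grad w z\<bar>) / 2"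

lemma tv_nonneg: "0 \<le> tv w"
  by (simp add: tv_def)

lemma TV_eq_tv:
  assumes w: "integrable \<nu> w"
  shows "TV m \<nu> w = ennreal (tv w)"
proof -
  have [measurable]: "grad w \<in> borel_measurable (borel \<Otimes>\<^sub>M borel)"
    by (rule grad_measurable[OF borel_measurable_integrable[OF w]])
  have [measurable]: "w \<in> borel_measurable borel"
    using borel_measurable_integrable[OF w] by measurable
  have "(\<integral>\<^sup>+x. (\<integral>\<^sup>+y. ennreal \<bar>w y - w x\<bar> \<partial>m x) \<partial>\<nu>) = (\<integral>\<^sup>+z. ennreal \<bar>grad w z\<bar> \<partial>joint)"
    by (subst nn_integral_joint) (auto simp: grad_def)
  also have "\<dots> = ennreal (LINT z|joint. \<bar>grad w z\<bar>)"
    using integrable_grad[OF w] by (intro nn_integral_eq_integral) auto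
  moreover have half: "(1 :: ennreal) / 2 = ennreal (1 / 2)"
    using divide_ennreal[of 1 2] by simp
  ultimately have "TV m \<nu> w = ennreal (1 / 2) * ennreal (LINT z|joint. \<bar>grad w z\<bar>)"
    unfolding TV_def half by metis
  also have "\<dots> = ennreal (tv w)"
    unfolding tv_def by (subst ennreal_mult[symmetric]) simp_all
  finally show ?thesis .
qed

lemma tv_nonexpansive_le:
  assumes w: "integrable \<nu> w" and w': "integrable \<nu> w'"
    and le: "\<And>x y. \<bar>w' x - w' y\<bar> \<le> \<bar>w x - w y\<bar>"
  shows "tv w' \<le> tv w"
proof -
  have "\<bar>grad w' z\<bar> \<le> \<bar>grad w z\<bar>" for z
    using le by (simp add: grad_def)
  then show ?thesis
    unfolding tv_def using integrable_grad[OF w] integrable_grad[OF w']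
    by (intro divide_right_mono integral_mono) auto
qed

subsection \<open>Averaging an antisymmetric field over one step\<close>

definition step_mean :: "('a \<times> 'a \<Rightarrow> real) \<Rightarrow> 'a \<Rightarrow> real" where
  "step_mean g x = (LINT y|m x. g (x, y))"

context
  fixes g :: "'a \<times> 'a \<Rightarrow> real"
  assumes g [measurable]: "g \<in> borel_measurable (borel \<Otimes>\<^sub>M borel)"
    and g_bdd: "\<And>z. \<bar>g z\<bar> \<le> 1"
begin

lemma integrable_section: "integrable (m x) (\<lambda>y. g (x, y))"
proof -
  interpret prob_space "m x" by (rule prob_m)
  show ?thesis using g_bdd by (intro integrable_AE_bounded[of _ 1]) auto
qed

lemma step_mean_measurable [measurable]: "step_mean g \<in> borel_measurable \<nu>"
proof -
  have "(\<lambda>x. LINT z|distr (m x) (borel \<Otimes>\<^sub>M borel) (Pair x). g z) \<in> borel_measurable \<nu>"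
    by measurable
  also have "(\<lambda>x. LINT z|distr (m x) (borel \<Otimes>\<^sub>M borel) (Pair x). g z) = step_mean g"
    unfolding step_mean_def by (intro ext integral_distr) measurable
  finally show ?thesis .
qed

lemma abs_step_mean_le: "\<bar>step_mean g x\<bar> \<le> 1"
proof -
  interpret prob_space "m x" by (rule prob_m)
  have "\<bar>step_mean g x\<bar> \<le> (LINT y|m x. \<bar>g (x, y)\<bar>)"
    unfolding step_mean_def by (rule integral_abs_bound)
  also have "\<dots> \<le> (LINT y|m x. 1)"
    using integrable_section g_bdd by (intro integral_mono) auto
  finally show ?thesis by (simp add: prob_space[simplified])
qed

text \<open>Adding \<open>1\<close> to \<open>g\<close> makes the integrand nonnegative, so that the iterated integral of
\<open>nn_integral_joint\<close> applies.\<close>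

lemma integral_step_mean_nonneg:
  assumes h: "integrable \<nu> h" "\<And>x. 0 \<le> h x"
  shows "(LINT z|joint. (1 + g z) * h (fst z)) = (LINT x|\<nu>. (1 + step_mean g x) * h x)"
proof -
  have [measurable]: "h \<in> borel_measurable borel"
    using borel_measurable_integrable[OF h(1)] by measurable
  have g1: "0 \<le> 1 + g z" for z using g_bdd[of z] by (auto simp: abs_le_iff)
  have g2: "0 \<le> 1 + step_mean g x" for x using abs_step_mean_le[of x] by (auto simp: abs_le_iff)
  have "(LINT z|joint. (1 + g z) * h (fst z)) = enn2real (\<integral>\<^sup>+z. ennreal ((1 + g z) * h (fst z)) \<partial>joint)"
    using g1 h(2) by (intro integral_eq_nn_integral) auto
  also have "(\<integral>\<^sup>+z. ennreal ((1 + g z) * h (fst z)) \<partial>joint)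
      = (\<integral>\<^sup>+x. \<integral>\<^sup>+y. ennreal ((1 + g (x, y)) * h x) \<partial>m x \<partial>\<nu>)"
    by (subst nn_integral_joint) auto
  also have "\<dots> = (\<integral>\<^sup>+x. ennreal ((1 + step_mean g x) * h x) \<partial>\<nu>)"
  proof (intro nn_integral_cong)
    fix x
    interpret prob_space "m x" by (rule prob_m)
    have "(\<integral>\<^sup>+y. ennreal ((1 + g (x, y)) * h x) \<partial>m x) = ennreal (LINT y|m x. (1 + g (x, y)) * h x)"
      using integrable_section g1 h(2) by (intro nn_integral_eq_integral) auto
    also have "(LINT y|m x. (1 + g (x, y)) * h x) = (1 + step_mean g x) * h x"
      using integrable_section by (simp add: step_mean_def prob_space[simplified])
    finally show "(\<integral>\<^sup>+y. ennreal ((1 + g (x, y)) * h x) \<partial>m x) = ennreal ((1 + step_mean g x) * h x)" .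
  qed
  also have "enn2real \<dots> = (LINT x|\<nu>. (1 + step_mean g x) * h x)"
    using g2 h(2) by (intro integral_eq_nn_integral[symmetric]) auto
  finally show ?thesis .
qed

lemma integral_step_mean:
  assumes h: "integrable \<nu> h"
  shows "(LINT z|joint. g z * h (fst z)) = (LINT x|\<nu>. step_mean g x * h x)"
proof -
  have nn: "(LINT z|joint. g z * h (fst z)) = (LINT x|\<nu>. step_mean g x * h x)"
    if h: "integrable \<nu> h" and "\<And>x. 0 \<le> h x" for h
  proof -
    have i: "integrable joint (\<lambda>z. g z * h (fst z))"
      using g_bdd by (intro integrable_bounded_mult[where R=1] integrable_joint_marginals h) auto
    have i': "integrable \<nu> (\<lambda>x. step_mean g x * h x)"
      using abs_step_mean_le by (intro integrable_bounded_mult[where R=1] h) auto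
    have "(LINT z|joint. h (fst z)) = (LINT x|\<nu>. h x)"
      using integral_distr[of fst joint \<nu> h] borel_measurable_integrable[OF h]
      by (simp add: distr_joint_fst)
    then show ?thesis
      using integral_step_mean_nonneg[OF that] i i' h integrable_joint_marginals(1)[OF h]
      by (simp add: distrib_right)
  qed
  have split: "c * h x = c * max 0 (h x) - c * max 0 (- h x)" for c x
    by (auto simp: max_def)
  have j: "integrable \<nu> (\<lambda>x. max 0 (h x))" "integrable \<nu> (\<lambda>x. max 0 (- h x))"
    using h by auto
  have i: "integrable joint (\<lambda>z. g z * k (fst z))" "integrable \<nu> (\<lambda>x. step_mean g x * k x)"
    if "integrable \<nu> k" for k
    using g_bdd abs_step_mean_le that
    by (auto intro!: integrable_bounded_mult[where R=1] integrable_joint_marginals)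
  show ?thesis
    unfolding split using i[OF j(1)] i[OF j(2)] nn[OF j(1)] nn[OF j(2)] by simp
qed

text \<open>Integration by parts: for antisymmetric fields, \<open>g \<mapsto> - step_mean g\<close> is the adjoint of half the
gradient, that is, a negative divergence. The symmetry of \<open>joint\<close> exchanges the two terms
of the gradient.\<close>

lemma integral_minus_step_mean_antisymmetric:
  assumes anti: "\<And>z. g (prod.swap z) = - g z" and h: "integrable \<nu> h"
  shows "(LINT x|\<nu>. - step_mean g x * h x) = (LINT z|joint. g z * grad h z) / 2"
proof -
  have [measurable]: "h \<in> borel_measurable borel"
    using borel_measurable_integrable[OF h] by measurable
  have i: "integrable joint (\<lambda>z. g z * h (fst z))" "integrable joint (\<lambda>z. g z * h (snd z))"
    using g_bdd by (auto intro!: integrable_bounded_mult[where R=1] integrable_joint_marginals h)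
  have "(LINT z|joint. g z * h (snd z)) = (LINT z|joint. g (prod.swap z) * h (snd (prod.swap z)))"
    by (subst integral_joint_swap[symmetric]) auto
  then have "(LINT z|joint. g z * h (snd z)) = - (LINT z|joint. g z * h (fst z))"
    by (simp add: anti)
  then have "(LINT z|joint. g z * grad h z) = - 2 * (LINT z|joint. g z * h (fst z))"
    using i by (simp add: grad_def right_diff_distrib)
  then show ?thesis by (simp add: integral_step_mean[OF h])
qed

end
end

section \<open>Square integrability from excess over levels\<close>

text \<open>If \<open>u > k \<ge> f\<close>, clamping \<open>u\<close> at \<open>k\<close> brings it closer to \<open>f\<close> by the whole excess \<open>u - k\<close>. The last
term pays for the points where \<open>f\<close> exceeds \<open>k\<close> as well.\<close>

lemma clamp_excess_le:
  fixes k u f :: real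
  assumes "0 \<le> k"
  shows "max 0 (\<bar>u\<bar> - k) \<le> \<bar>u - f\<bar> - \<bar>max (- k) (min k u) - f\<bar> + 2 * max 0 (\<bar>f\<bar> - k)"
  using assms by (auto simp: max_def min_def abs_if)

lemma clamp_nonexpansive:
  fixes k a b :: real
  shows "\<bar>max (- k) (min k a) - max (- k) (min k b)\<bar> \<le> \<bar>a - b\<bar>"
  by linarith

lemma abs_clamp_le:
  fixes k a :: real
  shows "0 \<le> k \<Longrightarrow> \<bar>max (- k) (min k a)\<bar> \<le> min k \<bar>a\<bar>"
  by linarith

lemma nn_integral_excess_eq_half_sq:
  fixes r :: real
  assumes "0 \<le> r"
  shows "(\<integral>\<^sup>+k. ennreal (max 0 (r - k)) * indicator {0..} k \<partial>lborel) = ennreal (r\<^sup>2 / 2)"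
proof -
  have "(\<integral>\<^sup>+k. ennreal (max 0 (r - k)) * indicator {0..} k \<partial>lborel)
      = (\<integral>\<^sup>+k. ennreal (r - k) * indicator {0..r} k \<partial>lborel)"
    by (intro nn_integral_cong) (auto simp: indicator_def max_def ennreal_neg)
  also have "\<dots> = ennreal ((r * r - r\<^sup>2 / 2) - (r * 0 - 0\<^sup>2 / 2))"
    using assms
    by (intro nn_integral_FTC_Icc) (auto intro!: derivative_eq_intros)
  finally show ?thesis by (simp add: power2_eq_square)
qed

text \<open>Integrate the hypothesis over the levels \<open>k \<ge> 0\<close> and exchange the integrals.\<close>

lemma (in finite_measure) nn_integral_sq_le_of_excess:
  fixes u f :: "'a \<Rightarrow> real"
  assumes u [measurable]: "u \<in> borel_measurable M" and f [measurable]: "f \<in> borel_measurable M"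
    and le: "\<And>k. 0 \<le> k \<Longrightarrow>
      (\<integral>\<^sup>+x. ennreal (max 0 (\<bar>u x\<bar> - k)) \<partial>M) \<le> 2 * (\<integral>\<^sup>+x. ennreal (max 0 (\<bar>f x\<bar> - k)) \<partial>M)"
  shows "(\<integral>\<^sup>+x. ennreal ((u x)\<^sup>2) \<partial>M) \<le> 2 * (\<integral>\<^sup>+x. ennreal ((f x)\<^sup>2) \<partial>M)"
proof -
  interpret P: pair_sigma_finite M lborel ..
  have half: "(\<integral>\<^sup>+x. ennreal ((w x)\<^sup>2 / 2) \<partial>M)
      = (\<integral>\<^sup>+k. (\<integral>\<^sup>+x. ennreal (max 0 (\<bar>w x\<bar> - k)) \<partial>M) * indicator {0..} k \<partial>lborel)"
    if [measurable]: "w \<in> borel_measurable M" for w :: "'a \<Rightarrow> real"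
  proof -
    have "(\<integral>\<^sup>+x. ennreal ((w x)\<^sup>2 / 2) \<partial>M)
        = (\<integral>\<^sup>+x. \<integral>\<^sup>+k. ennreal (max 0 (\<bar>w x\<bar> - k)) * indicator {0..} k \<partial>lborel \<partial>M)"
      using nn_integral_excess_eq_half_sq[of "\<bar>w x\<bar>" for x] by (intro nn_integral_cong) simp
    also have "\<dots> = (\<integral>\<^sup>+k. \<integral>\<^sup>+x. ennreal (max 0 (\<bar>w x\<bar> - k)) * indicator {0..} k \<partial>M \<partial>lborel)"
      by (rule P.Fubini'[symmetric]) measurable
    also have "\<dots> = (\<integral>\<^sup>+k. (\<integral>\<^sup>+x. ennreal (max 0 (\<bar>w x\<bar> - k)) \<partial>M) * indicator {0..} k \<partial>lborel)"
      by (intro nn_integral_cong nn_integral_multc) measurable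
    finally show ?thesis .
  qed
  have dbl: "(\<integral>\<^sup>+x. ennreal ((w x)\<^sup>2) \<partial>M) = 2 * (\<integral>\<^sup>+x. ennreal ((w x)\<^sup>2 / 2) \<partial>M)"
    if [measurable]: "w \<in> borel_measurable M" for w :: "'a \<Rightarrow> real"
  proof -
    have "ennreal ((w x)\<^sup>2) = 2 * ennreal ((w x)\<^sup>2 / 2)" for x
      using ennreal_mult[of 2 "(w x)\<^sup>2 / 2"] by simp
    then show ?thesis by (simp add: nn_integral_cmult)
  qed
  have "(\<integral>\<^sup>+x. ennreal ((u x)\<^sup>2 / 2) \<partial>M) \<le>
      (\<integral>\<^sup>+k. 2 * ((\<integral>\<^sup>+x. ennreal (max 0 (\<bar>f x\<bar> - k)) \<partial>M) * indicator {0..} k) \<partial>lborel)"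
    unfolding half[OF u]
  proof (intro nn_integral_mono)
    fix k :: real
    show "(\<integral>\<^sup>+x. ennreal (max 0 (\<bar>u x\<bar> - k)) \<partial>M) * indicator {0..} k
        \<le> 2 * ((\<integral>\<^sup>+x. ennreal (max 0 (\<bar>f x\<bar> - k)) \<partial>M) * indicator {0..} k)"
      using le[of k] by (cases "0 \<le> k") simp_all
  qed
  also have "\<dots> = 2 * (\<integral>\<^sup>+x. ennreal ((f x)\<^sup>2 / 2) \<partial>M)"
    unfolding half[OF f] by (rule nn_integral_cmult) measurable
  finally show ?thesis
    unfolding dbl[OF u] dbl[OF f] by (rule mult_left_mono) simp
qed

lemma (in finite_measure) L2_imp_integrable: "w \<in> L2 M \<Longrightarrow> integrable M w"
  by (rule square_integrable_imp_integrable) (simp_all add: L2_def)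

lemma (in finite_measure) AE_bounded_in_L2:
  assumes "w \<in> borel_measurable M" "AE x in M. \<bar>w x\<bar> \<le> R"
  shows "w \<in> L2 M"
  using integrable_AE_bounded_mult[OF assms assms] assms(1)
  by (simp add: L2_def power2_eq_square)

section \<open>Subgradients of the total variation\<close>

context reversible_walk
begin

text \<open>The bound \<open>1\<close> supplies the boundedness that the separation argument asks for; the explicit
subgradients \<open>- step_mean g\<close> satisfy it because \<open>g\<close> is a sign field.\<close>

definition tv_subgradients :: "('a \<Rightarrow> real) \<Rightarrow> ('a \<Rightarrow> real) set" where
  "tv_subgradients u = {b \<in> borel_measurable \<nu>. (AE x in \<nu>. \<bar>b x\<bar> \<le> 1) \<and>
     (\<forall>w. integrable \<nu> w \<longrightarrow> tv u + (LINT x|\<nu>. b x * (w x - u x)) \<le> tv w)}"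

lemma tv_subgradients_bounded_convex_closed:
  assumes u: "integrable \<nu> u" and "1 \<le> R"
  shows "bounded_convex_closed \<nu> R (tv_subgradients u)"
  unfolding bounded_convex_closed_def
proof (intro conjI ballI allI impI)
  fix b assume "b \<in> tv_subgradients u"
  then show "b \<in> borel_measurable \<nu>" by (simp add: tv_subgradients_def)
  have "AE x in \<nu>. \<bar>b x\<bar> \<le> 1"
    using \<open>b \<in> tv_subgradients u\<close> by (simp add: tv_subgradients_def)
  then show "AE x in \<nu>. \<bar>b x\<bar> \<le> R" by eventually_elim (use \<open>1 \<le> R\<close> in linarith)
next
  fix b b' and t :: real
  assume b: "b \<in> tv_subgradients u" "b' \<in> tv_subgradients u" and t: "t \<in> {0..1}"
  have bm [measurable]: "b \<in> borel_measurable \<nu>" "b' \<in> borel_measurable \<nu>"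
    and bb: "AE x in \<nu>. \<bar>b x\<bar> \<le> 1" "AE x in \<nu>. \<bar>b' x\<bar> \<le> 1"
    using b by (auto simp: tv_subgradients_def)
  have "AE x in \<nu>. \<bar>(1 - t) * b x + t * b' x\<bar> \<le> 1"
    using bb
  proof eventually_elim
    fix x assume "\<bar>b x\<bar> \<le> 1" "\<bar>b' x\<bar> \<le> 1"
    then show "\<bar>(1 - t) * b x + t * b' x\<bar> \<le> 1"
      using t convex_bound_le[of "b x" 1 "b' x" "1 - t" t] convex_bound_le[of "- b x" 1 "- b' x" "1 - t" t]
      by (auto simp: abs_le_iff)
  qed
  moreover have "tv u + (LINT x|\<nu>. ((1 - t) * b x + t * b' x) * (w x - u x)) \<le> tv w"
    if w: "integrable \<nu> w" for w
  proof -
    have i: "integrable \<nu> (\<lambda>x. b x * (w x - u x))" "integrable \<nu> (\<lambda>x. b' x * (w x - u x))"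
      using bb by (auto intro!: integrable_bounded_mult[where R=1] u w)
    have "(LINT x|\<nu>. ((1 - t) * b x + t * b' x) * (w x - u x))
        = (LINT x|\<nu>. (1 - t) * (b x * (w x - u x)) + t * (b' x * (w x - u x)))"
      by (simp add: algebra_simps)
    also have "\<dots> = (1 - t) * (LINT x|\<nu>. b x * (w x - u x)) + t * (LINT x|\<nu>. b' x * (w x - u x))"
      using i by simp
    also have "\<dots> \<le> (1 - t) * (tv w - tv u) + t * (tv w - tv u)"
    proof (intro add_mono mult_left_mono)
      have "tv u + (LINT x|\<nu>. b x * (w x - u x)) \<le> tv w" "tv u + (LINT x|\<nu>. b' x * (w x - u x)) \<le> tv w"
        using b w by (auto simp: tv_subgradients_def)
      then show "(LINT x|\<nu>. b x * (w x - u x)) \<le> tv w - tv u"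
        "(LINT x|\<nu>. b' x * (w x - u x)) \<le> tv w - tv u" by simp_all
    qed (use t in auto)
    finally show ?thesis by (simp add: algebra_simps)
  qed
  ultimately show "(\<lambda>x. (1 - t) * b x + t * b' x) \<in> tv_subgradients u"
    by (simp add: tv_subgradients_def)
next
  fix s :: "nat \<Rightarrow> 'a \<Rightarrow> real" and b
  assume s: "\<forall>n. s n \<in> tv_subgradients u" and bm [measurable]: "b \<in> borel_measurable \<nu>"
    and lim: "AE x in \<nu>. (\<lambda>n. s n x) \<longlonglongrightarrow> b x"
  have sm [measurable]: "s n \<in> borel_measurable \<nu>" and sb: "AE x in \<nu>. \<bar>s n x\<bar> \<le> 1" for n
    using s by (auto simp: tv_subgradients_def)
  have all: "AE x in \<nu>. \<forall>n. \<bar>s n x\<bar> \<le> 1" using sb by (simp add: AE_all_countable)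
  have "AE x in \<nu>. \<bar>b x\<bar> \<le> 1"
    using all lim by eventually_elim (rule LIMSEQ_le_const2[OF tendsto_rabs], auto)
  moreover have "tv u + (LINT x|\<nu>. b x * (w x - u x)) \<le> tv w" if w: "integrable \<nu> w" for w
  proof (rule LIMSEQ_le_const2)
    show "(\<lambda>n. tv u + (LINT x|\<nu>. s n x * (w x - u x))) \<longlonglongrightarrow> tv u + (LINT x|\<nu>. b x * (w x - u x))"
    proof (intro tendsto_intros integral_dominated_convergence[where w="\<lambda>x. \<bar>w x - u x\<bar>"])
      show "AE x in \<nu>. (\<lambda>n. s n x * (w x - u x)) \<longlonglongrightarrow> b x * (w x - u x)"
        using lim by eventually_elim (intro tendsto_intros)
      show "AE x in \<nu>. norm (s n x * (w x - u x)) \<le> \<bar>w x - u x\<bar>" for n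
        using sb[of n] by eventually_elim (simp add: abs_mult mult_left_le_one_le)
    qed (use u w in auto)
    show "\<exists>N. \<forall>n\<ge>N. tv u + (LINT x|\<nu>. s n x * (w x - u x)) \<le> tv w"
      using s w by (auto simp: tv_subgradients_def)
  qed
  ultimately show "b \<in> tv_subgradients u" by (simp add: tv_subgradients_def)
qed

lemma sign_multiples_bounded_convex_closed:
  assumes "0 < c" "c \<le> R" and [measurable]: "p \<in> borel_measurable \<nu>"
  shows "bounded_convex_closed \<nu> R {a. (\<lambda>x. a x / c) \<in> sign_selections \<nu> p}" (is "bounded_convex_closed _ _ ?A")
proof -
  have A: "a \<in> ?A \<longleftrightarrow> a \<in> borel_measurable \<nu> \<and> (AE x in \<nu>. a x / c \<in> multi_sign (p x))" for a
  proof -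
    have "a \<in> borel_measurable \<nu>" if "(\<lambda>x. a x / c) \<in> borel_measurable \<nu>"
    proof -
      have "(\<lambda>x. c * (a x / c)) \<in> borel_measurable \<nu>"
        using that by (rule borel_measurable_times[OF borel_measurable_const])
      also have "(\<lambda>x. c * (a x / c)) = a" using \<open>0 < c\<close> by simp
      finally show ?thesis .
    qed
    moreover have "(\<lambda>x. a x / c) \<in> borel_measurable \<nu>" if "a \<in> borel_measurable \<nu>"
      using that by measurable
    ultimately show ?thesis unfolding sign_selections_def mem_Collect_eq by blast
  qed
  show ?thesis
    unfolding bounded_convex_closed_def
  proof (intro conjI ballI allI impI)
    fix a assume a: "a \<in> ?A"
    then show "a \<in> borel_measurable \<nu>" unfolding A by blast
    have "AE x in \<nu>. a x / c \<in> multi_sign (p x)" using a unfolding A by blast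
    then show "AE x in \<nu>. \<bar>a x\<bar> \<le> R"
    proof eventually_elim
      fix x assume "a x / c \<in> multi_sign (p x)"
      from abs_le_1_of_multi_sign[OF this] show "\<bar>a x\<bar> \<le> R"
        using assms(1,2) by (simp add: abs_divide pos_divide_le_eq)
    qed
  next
    fix a a' and t :: real assume a: "a \<in> ?A" "a' \<in> ?A" and t: "t \<in> {0..1}"
    have [measurable]: "a \<in> borel_measurable \<nu>" "a' \<in> borel_measurable \<nu>" using a unfolding A by blast+
    have "(\<lambda>x. (1 - t) * a x + t * a' x) \<in> borel_measurable \<nu>" by measurable
    moreover have "AE x in \<nu>. a x / c \<in> multi_sign (p x)" "AE x in \<nu>. a' x / c \<in> multi_sign (p x)"
      using a unfolding A by blast+
    then have "AE x in \<nu>. ((1 - t) * a x + t * a' x) / c \<in> multi_sign (p x)"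
    proof eventually_elim
      fix x assume "a x / c \<in> multi_sign (p x)" "a' x / c \<in> multi_sign (p x)"
      from multi_sign_convex[OF this, of t] t
      show "((1 - t) * a x + t * a' x) / c \<in> multi_sign (p x)" by (simp add: add_divide_distrib)
    qed
    ultimately show "(\<lambda>x. (1 - t) * a x + t * a' x) \<in> ?A" unfolding A by blast
  next
    fix s :: "nat \<Rightarrow> 'a \<Rightarrow> real" and a
    assume s: "\<forall>n. s n \<in> ?A" and am: "a \<in> borel_measurable \<nu>" and lim: "AE x in \<nu>. (\<lambda>n. s n x) \<longlonglongrightarrow> a x"
    have "AE x in \<nu>. \<forall>n. s n x / c \<in> multi_sign (p x)"
      using s unfolding A AE_all_countable by blast
    then have "AE x in \<nu>. a x / c \<in> multi_sign (p x)"
      using lim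
    proof eventually_elim
      fix x assume sx: "\<forall>n. s n x / c \<in> multi_sign (p x)" and "(\<lambda>n. s n x) \<longlonglongrightarrow> a x"
      then have "(\<lambda>n. s n x / c) \<longlonglongrightarrow> a x / c"
        by (intro tendsto_divide tendsto_const less_imp_neq[OF \<open>0 < c\<close>, symmetric])
      with sx show "a x / c \<in> multi_sign (p x)"
        using multi_sign_closed[of "\<lambda>n. s n x / c"] by blast
    qed
    with am show "a \<in> ?A" unfolding A by blast
  qed
qed

text \<open>An explicit subgradient that attains the directional derivative of the total variation at \<open>u\<close>
in direction \<open>h\<close>. The field \<open>g\<close> is antisymmetric and a pointwise subgradient of the absolute value
at \<open>grad u\<close>, so integration by parts carries the pointwise inequality over to \<open>X\<close>.\<close>

lemma dir_sgn_step_mean_subgradient: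
  assumes u: "integrable \<nu> u" and h: "integrable \<nu> h"
  defines "g \<equiv> (\<lambda>z. dir_sgn (grad u z) (grad h z))"
  shows "(\<lambda>x. - step_mean g x) \<in> tv_subgradients u"
    and "(LINT x|\<nu>. - step_mean g x * h x) = (LINT z|joint. dir_sgn (grad u z) (grad h z) * grad h z) / 2"
proof -
  have [measurable]: "grad w \<in> borel_measurable (borel \<Otimes>\<^sub>M borel)" if "integrable \<nu> w" for w
    using grad_measurable[OF borel_measurable_integrable[OF that]] .
  have gm: "g \<in> borel_measurable (borel \<Otimes>\<^sub>M borel)" unfolding g_def using u h by measurable
  have gb: "\<bar>g z\<bar> \<le> 1" for z unfolding g_def by (rule abs_dir_sgn_le)
  have anti: "g (prod.swap z) = - g z" for z
    using dir_sgn_minus[of "grad u z" "grad h z"] by (simp add: g_def grad_def)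
  note rep = integral_minus_step_mean_antisymmetric[OF gm gb anti]
  show "(LINT x|\<nu>. - step_mean g x * h x) = (LINT z|joint. dir_sgn (grad u z) (grad h z) * grad h z) / 2"
    using rep[OF h] by (simp add: g_def)
  have "tv u + (LINT x|\<nu>. - step_mean g x * (w x - u x)) \<le> tv w" if w: "integrable \<nu> w" for w
  proof -
    have i: "integrable joint (\<lambda>z. g z * grad v z)" if "integrable \<nu> v" for v
      using gm gb by (intro integrable_bounded_mult[where R=1] integrable_grad that) auto
    have wu: "integrable \<nu> (\<lambda>x. w x - u x)" using w u by simp
    have "(LINT x|\<nu>. - step_mean g x * (w x - u x)) = (LINT z|joint. g z * grad (\<lambda>x. w x - u x) z) / 2"
      by (rule rep[OF wu])
    also have "\<dots> \<le> (LINT z|joint. \<bar>grad w z\<bar> - \<bar>grad u z\<bar>) / 2"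
    proof (intro divide_right_mono integral_mono)
      fix z
      show "g z * grad (\<lambda>x. w x - u x) z \<le> \<bar>grad w z\<bar> - \<bar>grad u z\<bar>"
        using multi_sign_subgradient_abs[OF dir_sgn_in_multi_sign[of "grad u z" "grad h z"], of "grad w z"]
        by (simp add: g_def grad_def algebra_simps)
    qed (use i[OF wu] integrable_grad[OF w] integrable_grad[OF u] in auto)
    also have "\<dots> = tv w - tv u"
      using integrable_grad[OF w] integrable_grad[OF u] by (simp add: tv_def diff_divide_distrib)
    finally show ?thesis by simp
  qed
  then show "(\<lambda>x. - step_mean g x) \<in> tv_subgradients u"
    using step_mean_measurable[OF gm gb] abs_step_mean_le[OF gm gb] by (simp add: tv_subgradients_def)
qed

lemma minimizer_directional_derivative_nonneg:
  assumes f: "integrable \<nu> f" and u: "integrable \<nu> u" and h: "integrable \<nu> h"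
    and min: "\<And>w. integrable \<nu> w \<Longrightarrow>
       tv u + lam * (LINT x|\<nu>. \<bar>u x - f x\<bar>) \<le> tv w + lam * (LINT x|\<nu>. \<bar>w x - f x\<bar>)"
  shows "0 \<le> (LINT z|joint. dir_sgn (grad u z) (grad h z) * grad h z) / 2
           + lam * (LINT x|\<nu>. dir_sgn (u x - f x) (h x) * h x)"
proof (rule LIMSEQ_le_const)
  let ?T = "\<lambda>n. ((LINT z|joint. \<bar>grad u z + grad h z / (real n + 1)\<bar>) - (LINT z|joint. \<bar>grad u z\<bar>)) * (real n + 1)"
  let ?G = "\<lambda>n. ((LINT x|\<nu>. \<bar>(u x - f x) + h x / (real n + 1)\<bar>) - (LINT x|\<nu>. \<bar>u x - f x\<bar>)) * (real n + 1)"
  show "(\<lambda>n. ?T n / 2 + lam * ?G n) \<longlonglongrightarrow> (LINT z|joint. dir_sgn (grad u z) (grad h z) * grad h z) / 2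
           + lam * (LINT x|\<nu>. dir_sgn (u x - f x) (h x) * h x)"
    using f u h by (intro tendsto_intros integral_abs_difference_quotient_tendsto integrable_grad) auto
  have "0 \<le> ?T n / 2 + lam * ?G n" for n
  proof -
    let ?w = "\<lambda>x. u x + h x / (real n + 1)"
    have "grad ?w z = grad u z + grad h z / (real n + 1)" for z
      by (simp add: grad_def diff_divide_distrib)
    then have "?T n / 2 + lam * ?G n =
        ((tv ?w + lam * (LINT x|\<nu>. \<bar>?w x - f x\<bar>)) - (tv u + lam * (LINT x|\<nu>. \<bar>u x - f x\<bar>))) * (real n + 1)"
      by (simp add: tv_def algebra_simps add_divide_distrib diff_divide_distrib)
    moreover have "0 \<le> (tv ?w + lam * (LINT x|\<nu>. \<bar>?w x - f x\<bar>)) - (tv u + lam * (LINT x|\<nu>. \<bar>u x - f x\<bar>))"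
      using min[of ?w] u h by simp
    ultimately show ?thesis by simp
  qed
  then show "\<exists>N. \<forall>n\<ge>N. 0 \<le> ?T n / 2 + lam * ?G n" by blast
qed

text \<open>For each direction \<open>h\<close> the two explicit selections \<open>a = lam * dir_sgn (u - f) h\<close> and \<open>b\<close>, the
subgradient above, have a sum whose pairing with \<open>h\<close> is the directional derivative of the energy,
hence nonnegative. They depend on \<open>h\<close>; the separation argument gives one pair with \<open>a + b = 0\<close>.\<close>

proposition minimizer_imp_subgradient:
  assumes f: "integrable \<nu> f" and u: "integrable \<nu> u" and lam: "0 < lam"
    and min: "\<And>w. integrable \<nu> w \<Longrightarrow>
       tv u + lam * (LINT x|\<nu>. \<bar>u x - f x\<bar>) \<le> tv w + lam * (LINT x|\<nu>. \<bar>w x - f x\<bar>)"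
  obtains \<xi> where "\<xi> \<in> sign_selections \<nu> (\<lambda>x. u x - f x)" "(\<lambda>x. - (lam * \<xi> x)) \<in> tv_subgradients u"
proof -
  note [measurable] = borel_measurable_integrable[OF u] borel_measurable_integrable[OF f]
  let ?A = "{a. (\<lambda>x. a x / lam) \<in> sign_selections \<nu> (\<lambda>x. u x - f x)}"
  obtain a where a: "a \<in> ?A" "(\<lambda>x. - a x) \<in> tv_subgradients u"
  proof (rule \<nu>.opposite_elements_of_bounded_convex_closed)
    show "bounded_convex_closed \<nu> (1 + lam) ?A"
      using lam by (intro sign_multiples_bounded_convex_closed) auto
    show "bounded_convex_closed \<nu> (1 + lam) (tv_subgradients u)"
      using lam by (intro tv_subgradients_bounded_convex_closed u) auto
    show "0 \<le> 1 + lam" using lam by simp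
    fix h assume hm [measurable]: "h \<in> borel_measurable \<nu>" and hb: "AE x in \<nu>. \<bar>h x\<bar> \<le> 2 * (1 + lam)"
    have h: "integrable \<nu> h" by (rule \<nu>.integrable_AE_bounded[OF hm hb])
    define g where "g = (\<lambda>z. dir_sgn (grad u z) (grad h z))"
    define a where "a x = lam * dir_sgn (u x - f x) (h x)" for x
    define b where "b x = - step_mean g x" for x
    have am [measurable]: "a \<in> borel_measurable \<nu>" unfolding a_def by measurable
    have aA: "a \<in> ?A"
      using lam dir_sgn_in_multi_sign by (simp add: a_def sign_selections_def)
    have bB: "b \<in> tv_subgradients u"
      and bh: "(LINT x|\<nu>. b x * h x) = (LINT z|joint. dir_sgn (grad u z) (grad h z) * grad h z) / 2"
      using dir_sgn_step_mean_subgradient[OF u h] unfolding b_def g_def by auto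
    have "AE x in \<nu>. \<bar>a x\<bar> \<le> lam"
      using lam abs_dir_sgn_le by (auto simp: a_def abs_mult mult_left_le)
    then have ia: "integrable \<nu> (\<lambda>x. a x * h x)" by (intro integrable_bounded_mult[OF h am])
    have ib: "integrable \<nu> (\<lambda>x. b x * h x)"
      using bB by (intro integrable_bounded_mult[OF h, of _ 1]) (auto simp: tv_subgradients_def)
    have "(LINT x|\<nu>. a x * h x) = lam * (LINT x|\<nu>. dir_sgn (u x - f x) (h x) * h x)"
      by (simp add: a_def mult.assoc)
    then have "0 \<le> (LINT x|\<nu>. (a x + b x) * h x)"
      using minimizer_directional_derivative_nonneg[OF f u h min] ia ib bh
      by (simp add: distrib_right)
    then show "\<exists>a\<in>?A. \<exists>b\<in>tv_subgradients u. 0 \<le> (LINT x|\<nu>. (a x + b x) * h x)"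
      by (rule bexI[OF bexI[OF _ bB] aA])
  qed blast
  show thesis
  proof (rule that)
    show "(\<lambda>x. a x / lam) \<in> sign_selections \<nu> (\<lambda>x. u x - f x)" using a(1) by simp
    show "(\<lambda>x. - (lam * (a x / lam))) \<in> tv_subgradients u" using a(2) lam by simp
  qed
qed

section \<open>Minimizers and subgradients\<close>

text \<open>A minimizer is a priori only integrable. Clamping it at level \<open>k\<close> is nonexpansive, so it does
not increase the total variation, and minimality says that it does not decrease the distance to
\<open>f\<close>. This bounds the excess of \<open>\<bar>u\<bar>\<close> over \<open>k\<close> by twice that of \<open>\<bar>f\<bar>\<close> for every \<open>k\<close>, and integration over
\<open>k\<close> gives \<open>\<parallel>u\<parallel>\<^sup>2 \<le> 2 \<parallel>f\<parallel>\<^sup>2\<close> in \<open>L\<^sup>2\<close>.\<close>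

lemma minimizer_in_L2:
  assumes f: "f \<in> L2 \<nu>" and u: "integrable \<nu> u" and lam: "0 < lam"
    and min: "\<And>w. integrable \<nu> w \<Longrightarrow>
       tv u + lam * (LINT x|\<nu>. \<bar>u x - f x\<bar>) \<le> tv w + lam * (LINT x|\<nu>. \<bar>w x - f x\<bar>)"
  shows "u \<in> L2 \<nu>"
proof -
  have fi: "integrable \<nu> f" by (rule \<nu>.L2_imp_integrable[OF f])
  note [measurable] = borel_measurable_integrable[OF u] borel_measurable_integrable[OF fi]
  have "(\<integral>\<^sup>+x. ennreal (max 0 (\<bar>u x\<bar> - k)) \<partial>\<nu>) \<le> 2 * (\<integral>\<^sup>+x. ennreal (max 0 (\<bar>f x\<bar> - k)) \<partial>\<nu>)"
    if k: "0 \<le> k" for k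
  proof -
    let ?w = "\<lambda>x. max (- k) (min k (u x))"
    have w: "integrable \<nu> ?w"
    proof (rule \<nu>.integrable_AE_bounded)
      show "AE x in \<nu>. \<bar>?w x\<bar> \<le> k" using abs_clamp_le[OF k] by simp
    qed measurable
    have iu: "integrable \<nu> (\<lambda>x. max 0 (\<bar>u x\<bar> - k))" and if': "integrable \<nu> (\<lambda>x. max 0 (\<bar>f x\<bar> - k))"
      using u fi by auto
    have "tv ?w \<le> tv u"
      by (rule tv_nonexpansive_le[OF u w clamp_nonexpansive])
    then have "lam * (LINT x|\<nu>. \<bar>u x - f x\<bar>) \<le> lam * (LINT x|\<nu>. \<bar>?w x - f x\<bar>)"
      using min[OF w] by linarith
    then have fid: "(LINT x|\<nu>. \<bar>u x - f x\<bar>) \<le> (LINT x|\<nu>. \<bar>?w x - f x\<bar>)" using lam by simp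
    have "(LINT x|\<nu>. max 0 (\<bar>u x\<bar> - k))
        \<le> (LINT x|\<nu>. \<bar>u x - f x\<bar> - \<bar>?w x - f x\<bar> + 2 * max 0 (\<bar>f x\<bar> - k))"
      using u fi w iu if' clamp_excess_le[OF k] by (intro integral_mono) auto
    also have "\<dots> = (LINT x|\<nu>. \<bar>u x - f x\<bar>) - (LINT x|\<nu>. \<bar>?w x - f x\<bar>)
        + 2 * (LINT x|\<nu>. max 0 (\<bar>f x\<bar> - k))"
      using u fi w if' by simp
    also have "\<dots> \<le> 2 * (LINT x|\<nu>. max 0 (\<bar>f x\<bar> - k))" using fid by simp
    finally have "ennreal (LINT x|\<nu>. max 0 (\<bar>u x\<bar> - k)) \<le> 2 * ennreal (LINT x|\<nu>. max 0 (\<bar>f x\<bar> - k))"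
      by (metis ennreal_leI ennreal_mult' ennreal_numeral zero_le_numeral)
    moreover have "(\<integral>\<^sup>+x. ennreal (max 0 (\<bar>u x\<bar> - k)) \<partial>\<nu>) = ennreal (LINT x|\<nu>. max 0 (\<bar>u x\<bar> - k))"
      by (rule nn_integral_eq_integral[OF iu]) simp
    moreover have "(\<integral>\<^sup>+x. ennreal (max 0 (\<bar>f x\<bar> - k)) \<partial>\<nu>) = ennreal (LINT x|\<nu>. max 0 (\<bar>f x\<bar> - k))"
      by (rule nn_integral_eq_integral[OF if']) simp
    ultimately show ?thesis by (simp only:)
  qed
  then have "(\<integral>\<^sup>+x. ennreal ((u x)\<^sup>2) \<partial>\<nu>) \<le> 2 * (\<integral>\<^sup>+x. ennreal ((f x)\<^sup>2) \<partial>\<nu>)"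
    by (intro \<nu>.nn_integral_sq_le_of_excess) auto
  also have "\<dots> < \<infinity>"
    using f unfolding L2_def integrable_iff_bounded by (simp add: ennreal_mult_less_top)
  finally show ?thesis
    unfolding L2_def integrable_iff_bounded by simp
qed

text \<open>Adding the subgradient inequalities of the two terms settles competitors in \<open>L\<^sup>2\<close>. An integrable
competitor \<open>w\<close> is reached through its truncations, which have no larger total variation and whose
distance to \<open>f\<close> converges.\<close>

lemma subgradient_imp_minimizer:
  assumes f: "f \<in> L2 \<nu>" and u: "integrable \<nu> u" and lam: "0 < lam"
    and \<xi>: "\<xi> \<in> sign_selections \<nu> (\<lambda>x. u x - f x)"
    and sub: "\<And>w. w \<in> L2 \<nu> \<Longrightarrow> tv u + (LINT x|\<nu>. - (lam * \<xi> x) * (w x - u x)) \<le> tv w"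
    and w: "integrable \<nu> w"
  shows "tv u + lam * (LINT x|\<nu>. \<bar>u x - f x\<bar>) \<le> tv w + lam * (LINT x|\<nu>. \<bar>w x - f x\<bar>)"
proof -
  have fi: "integrable \<nu> f" by (rule \<nu>.L2_imp_integrable[OF f])
  note [measurable] = borel_measurable_integrable[OF u] borel_measurable_integrable[OF fi]
    borel_measurable_integrable[OF w]
  have \<xi>m [measurable]: "\<xi> \<in> borel_measurable \<nu>" and \<xi>s: "AE x in \<nu>. \<xi> x \<in> multi_sign (u x - f x)"
    using \<xi> by (auto simp: sign_selections_def)
  have \<xi>b: "AE x in \<nu>. \<bar>\<xi> x\<bar> \<le> 1" using \<xi>s by eventually_elim (rule abs_le_1_of_multi_sign)
  let ?c = "\<lambda>n x. max (- real n) (min (real n) (w x))"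
  have step: "tv u + lam * (LINT x|\<nu>. \<bar>u x - f x\<bar>) \<le> tv w + lam * (LINT x|\<nu>. \<bar>?c n x - f x\<bar>)" for n
  proof -
    have c2: "?c n \<in> L2 \<nu>"
    proof (rule \<nu>.AE_bounded_in_L2)
      show "AE x in \<nu>. \<bar>?c n x\<bar> \<le> real n" using abs_clamp_le[of "real n"] by simp
    qed measurable
    then have c: "integrable \<nu> (?c n)" by (rule \<nu>.L2_imp_integrable)
    have i: "integrable \<nu> (\<lambda>x. \<xi> x * (?c n x - u x))"
      using \<xi>b by (intro integrable_bounded_mult[where R=1]) (use c u in auto)
    have "(LINT x|\<nu>. \<xi> x * (?c n x - u x)) \<le> (LINT x|\<nu>. \<bar>?c n x - f x\<bar> - \<bar>u x - f x\<bar>)"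
    proof (rule integral_mono_AE[OF i])
      show "AE x in \<nu>. \<xi> x * (?c n x - u x) \<le> \<bar>?c n x - f x\<bar> - \<bar>u x - f x\<bar>"
        using \<xi>s
      proof eventually_elim
        fix x assume "\<xi> x \<in> multi_sign (u x - f x)"
        from multi_sign_subgradient_abs[OF this, of "?c n x - f x"]
        show "\<xi> x * (?c n x - u x) \<le> \<bar>?c n x - f x\<bar> - \<bar>u x - f x\<bar>" by simp
      qed
    qed (use c u fi in auto)
    also have "\<dots> = (LINT x|\<nu>. \<bar>?c n x - f x\<bar>) - (LINT x|\<nu>. \<bar>u x - f x\<bar>)" using c u fi by simp
    finally have "lam * (LINT x|\<nu>. \<xi> x * (?c n x - u x))
        \<le> lam * ((LINT x|\<nu>. \<bar>?c n x - f x\<bar>) - (LINT x|\<nu>. \<bar>u x - f x\<bar>))"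
      using lam by simp
    moreover have "tv u - lam * (LINT x|\<nu>. \<xi> x * (?c n x - u x)) \<le> tv (?c n)"
      using sub[OF c2] by (simp add: mult.assoc)
    moreover have "tv (?c n) \<le> tv w"
      by (rule tv_nonexpansive_le[OF w c clamp_nonexpansive])
    ultimately show ?thesis by (simp add: right_diff_distrib)
  qed
  have "(\<lambda>n. tv w + lam * (LINT x|\<nu>. \<bar>?c n x - f x\<bar>)) \<longlonglongrightarrow> tv w + lam * (LINT x|\<nu>. \<bar>w x - f x\<bar>)"
  proof (intro tendsto_intros integral_dominated_convergence[where w="\<lambda>x. \<bar>w x\<bar> + \<bar>f x\<bar>"])
    show "AE x in \<nu>. (\<lambda>n. \<bar>?c n x - f x\<bar>) \<longlonglongrightarrow> \<bar>w x - f x\<bar>"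
    proof (rule AE_I2)
      fix x
      obtain N :: nat where N: "\<bar>w x\<bar> \<le> real N" using real_arch_simple by blast
      have "\<forall>\<^sub>F n in sequentially. \<bar>?c n x - f x\<bar> = \<bar>w x - f x\<bar>"
        using eventually_ge_at_top[of N]
      proof eventually_elim
        fix n assume "N \<le> n"
        then have "\<bar>w x\<bar> \<le> real n" using N by linarith
        then have "?c n x = w x" by linarith
        then show "\<bar>?c n x - f x\<bar> = \<bar>w x - f x\<bar>" by simp
      qed
      then show "(\<lambda>n. \<bar>?c n x - f x\<bar>) \<longlonglongrightarrow> \<bar>w x - f x\<bar>" by (rule tendsto_eventually)
    qed
    show "AE x in \<nu>. norm \<bar>?c n x - f x\<bar> \<le> \<bar>w x\<bar> + \<bar>f x\<bar>" for n
    proof (rule AE_I2)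
      fix x
      have "\<bar>?c n x\<bar> \<le> \<bar>w x\<bar>" using abs_clamp_le[of "real n" "w x"] by simp
      then show "norm \<bar>?c n x - f x\<bar> \<le> \<bar>w x\<bar> + \<bar>f x\<bar>"
        using abs_triangle_ineq4[of "?c n x" "f x"] by simp
    qed
  qed (use w fi in auto)
  then show ?thesis using step by (intro LIMSEQ_le_const) auto
qed

lemma energy_eq:
  assumes "integrable \<nu> w"
  shows "energy m \<nu> f lam w = ereal (tv w + lam * (LINT x|\<nu>. \<bar>w x - f x\<bar>))"
  by (simp add: energy_def TV_eq_tv[OF assms] tv_nonneg)

lemma subdifferential_F_TV_iff:
  "v \<in> subdifferential \<nu> (F_TV m \<nu>) u \<longleftrightarrow> u \<in> L2 \<nu> \<and> v \<in> L2 \<nu> \<and>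
     (\<forall>w\<in>L2 \<nu>. tv u + (LINT x|\<nu>. v x * (w x - u x)) \<le> tv w)"
  by (auto simp: subdifferential_def F_TV_def TV_eq_tv \<nu>.L2_imp_integrable tv_nonneg)

end

theorem theorem3p5:
  fixes m :: "'a::polish_space \<Rightarrow> 'a measure"
    and \<nu> :: "'a measure"
    and f u :: "'a \<Rightarrow> real"
    and lam :: real
  assumes "metric_random_walk m"
    and "radon_measure \<nu>"
    and "finite_measure \<nu>"
    and "emeasure \<nu> UNIV \<noteq> 0"
    and "reversible m \<nu>"
    and "ergodic m \<nu>"
    and "f \<in> L2 \<nu>"
    and "lam > 0"
    and "u \<in> L1 \<nu>"
  shows "u \<in> minimizers m \<nu> f lam \<longleftrightarrow>
    (\<exists>\<xi> \<in> sign_selections \<nu> (\<lambda>x. u x - f x). (\<lambda>x. lam * \<xi> x) \<in> one_laplacian m \<nu> u)"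
proof -
  interpret reversible_walk m \<nu>
    using assms(1-3,5) by (intro reversible_walk.intro) (simp_all add: radon_measure_def)
  have u: "integrable \<nu> u" using assms(9) by (simp add: L1_def)
  have f: "integrable \<nu> f" by (rule \<nu>.L2_imp_integrable[OF assms(7)])
  have min_iff: "u \<in> minimizers m \<nu> f lam \<longleftrightarrow> (\<forall>w. integrable \<nu> w \<longrightarrow>
      tv u + lam * (LINT x|\<nu>. \<bar>u x - f x\<bar>) \<le> tv w + lam * (LINT x|\<nu>. \<bar>w x - f x\<bar>))"
    using u by (auto simp: minimizers_def L1_def energy_eq)
  show ?thesis
  proof
    assume "u \<in> minimizers m \<nu> f lam"
    then have min: "tv u + lam * (LINT x|\<nu>. \<bar>u x - f x\<bar>) \<le> tv w + lam * (LINT x|\<nu>. \<bar>w x - f x\<bar>)"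
      if "integrable \<nu> w" for w using that min_iff by blast
    obtain \<xi> where \<xi>: "\<xi> \<in> sign_selections \<nu> (\<lambda>x. u x - f x)"
      and sub: "(\<lambda>x. - (lam * \<xi> x)) \<in> tv_subgradients u"
      using minimizer_imp_subgradient[OF f u assms(8) min] by blast
    have u2: "u \<in> L2 \<nu>" by (rule minimizer_in_L2[OF assms(7) u assms(8) min])
    have \<xi>2: "(\<lambda>x. - (lam * \<xi> x)) \<in> L2 \<nu>"
      using sub by (intro \<nu>.AE_bounded_in_L2[of _ 1]) (auto simp: tv_subgradients_def)
    then have "(\<lambda>x. lam * \<xi> x) \<in> L2 \<nu>"
      using \<xi> by (auto simp: L2_def sign_selections_def)
    then have "(\<lambda>x. lam * \<xi> x) \<in> one_laplacian m \<nu> u"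
      using sub u2 \<xi>2 \<nu>.L2_imp_integrable
      by (auto simp: one_laplacian_def subdifferential_F_TV_iff tv_subgradients_def)
    with \<xi> show "\<exists>\<xi> \<in> sign_selections \<nu> (\<lambda>x. u x - f x). (\<lambda>x. lam * \<xi> x) \<in> one_laplacian m \<nu> u"
      by blast
  next
    assume "\<exists>\<xi> \<in> sign_selections \<nu> (\<lambda>x. u x - f x). (\<lambda>x. lam * \<xi> x) \<in> one_laplacian m \<nu> u"
    then obtain \<xi> where \<xi>: "\<xi> \<in> sign_selections \<nu> (\<lambda>x. u x - f x)"
      and sub: "\<And>w. w \<in> L2 \<nu> \<Longrightarrow> tv u + (LINT x|\<nu>. - (lam * \<xi> x) * (w x - u x)) \<le> tv w"
      unfolding one_laplacian_def subdifferential_F_TV_iff by blast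
    show "u \<in> minimizers m \<nu> f lam"
      unfolding min_iff using subgradient_imp_minimizer[OF assms(7) u assms(8) \<xi> sub] by blast
  qed
qed

end
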